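(* Let $q>1$ be a real number and $m$ a positive integer. Then the set $Y^m(q)$ has no accumulation points in $\mathbb{R}$ if and only if $q$ is a Pisot number or $q\ge m+1$.
   Context: For a real number $q>1$ and a positive integer $m$, $Y^m(q)=\left\{\sum_{i=0}^n s_iq^i : n\in\{0,1,2,\ldots\},\ s_i\in\{0,\pm1,\ldots,\pm m\}\right\}$, i.e. the set of values $p(q)$ where $p$ runs over the polynomials with integer coefficients of absolute value at most $m$. A real number $\alpha$ is an accumulation point of a set $Y\subset\mathbb{R}$ if there is a sequence of elements of $Y$, all different from $\alpha$, converging to $\alpha$. A Pisot number is a real algebraic integer $>1$ all of whose other algebraic conjugates have modulus strictly less than one (in particular, integers $\ge 2$ are Pisot numbers). *)

theory Defs
  imports "HOL-Analysis.Analysis" "HOL-Computational_Algebra.Computational_Algebra"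
begin

definition Y_set :: "nat \<Rightarrow> real \<Rightarrow> real set" where
  "Y_set m q =
     {(\<Sum>i\<le>n. of_int (s i) * q ^ i) | (n :: nat) (s :: nat \<Rightarrow> int). \<forall>i\<le>n. \<bar>s i\<bar> \<le> int m}"

text \<open>The minimal polynomial over the rationals: the monic irreducible rational polynomial
  vanishing at \<open>x\<close>. The predicate holds for no \<open>p\<close> if \<open>x\<close> is transcendental.\<close>

definition is_min_poly :: "rat poly \<Rightarrow> 'a :: field_char_0 \<Rightarrow> bool" where
  "is_min_poly p x \<longleftrightarrow>
     lead_coeff p = 1 \<and> irreducible p \<and> poly (map_poly of_rat p) x = 0"

text \<open>Conjugates range over the complex numbers, also when \<open>x\<close> is real; an algebraic number
  is one of its own conjugates.\<close>

definition alg_conjugate :: "complex \<Rightarrow> complex \<Rightarrow> bool" where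
  "alg_conjugate x z \<longleftrightarrow> (\<exists>p. is_min_poly p x \<and> poly (map_poly of_rat p) z = 0)"

definition pisot :: "real \<Rightarrow> bool" where
  "pisot q \<longleftrightarrow>
     q > 1 \<and> algebraic_int q \<and>
     (\<forall>z. alg_conjugate (of_real q) z \<and> z \<noteq> of_real q \<longrightarrow> norm z < 1)"

end

theory Submission
  imports Defs
begin

text \<open>
  If \<open>q\<close> is a Pisot number, successive synthetic division by \<open>x - z\<close>, where \<open>z\<close> runs through \<open>q\<close> and its
  conjugates, bounds the remainder of a polynomial of height \<open>m\<close> modulo the minimal polynomial as soon as
  its value at \<open>q\<close> is bounded; so only finitely many values are possible.

  Conversely let \<open>q < m + 1\<close> and let the spectrum \<open>Y\<close> be locally finite.  The greedy orbit of 1 lies in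
  \<open>Y \<inter> [0, 1]\<close>, hence \<open>q\<close> is an algebraic integer, and only irrational \<open>q\<close> matter.  Follow the expansion of 1
  with all digits equal to \<open>m\<close> as long as possible.  If it terminates after one more digit, then \<open>q\<close> is a Pisot
  number by the theorem of Enestrom and Kakeya.  Otherwise there is \<open>a\<close> with \<open>a, 1 - a \<in> Y \<inter> (0, 1)\<close>.
  Translations by \<open>a\<close> and by \<open>a / q\<close> change digit expansions only by finitely many errors, and the
  Euclidean algorithm applied to \<open>a\<close> and \<open>a / q\<close> produces \<open>h > 0\<close> so small that the sets \<open>Y - q ^ i * h\<close>
  have finitely many elements in \<open>[-1, 1]\<close> altogether.

  Let \<open>z \<noteq> q\<close> be a conjugate with \<open>|z| \<ge> 1\<close>.  Then \<open>|z| < q\<close>, so the conjugates of integer parts grow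
  sublinearly, and the mean of the conjugate error of the translation by \<open>q ^ i * h\<close> is \<open>- z ^ i\<close> times the
  conjugate of \<open>h\<close>.  But the errors are driven by a finite Markov chain, so the sequence of these means can only
  be a multiple of \<open>z ^ i\<close> if \<open>z\<close> is a root of unity, which is absurd.
\<close>

section \<open>Integer polynomials and conjugates\<close>

text \<open>One setting for \<open>of_int\<close> and \<open>of_rat\<close>, in which
  \<open>map_poly\<close> is a ring homomorphism of polynomials.\<close>

locale ring_embedding =
  fixes f :: "'a :: comm_ring_1 \<Rightarrow> 'b :: comm_ring_1"
  assumes f_0 [simp]: "f 0 = 0" and f_1 [simp]: "f 1 = 1"
    and f_add: "f (x + y) = f x + f y" and f_mult: "f (x * y) = f x * f y"
begin

lemma map_poly_add: "map_poly f (p + r) = map_poly f p + map_poly f r"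
  by (intro poly_eqI) (simp add: coeff_map_poly f_add)

lemma map_poly_smult_hom: "map_poly f (smult c p) = smult (f c) (map_poly f p)"
  by (intro poly_eqI) (simp add: coeff_map_poly f_mult)

lemma map_poly_mult: "map_poly f (p * r) = map_poly f p * map_poly f r"
proof (induction p)
  case (pCons a p)
  then show ?case
    by (simp add: mult_pCons_left map_poly_add map_poly_smult_hom map_poly_pCons)
qed simp

lemma f_uminus: "f (- x) = - f x"
  using f_add[of x "-x"] by (simp add: eq_neg_iff_add_eq_0 add.commute)

lemma f_diff: "f (x - y) = f x - f y"
  using f_add[of x "-y"] by (simp add: f_uminus)

lemma map_poly_diff: "map_poly f (p - r) = map_poly f p - map_poly f r"
  by (intro poly_eqI) (simp add: coeff_map_poly f_diff)

end

lemma ring_embedding_of_int: "ring_embedding (of_int :: int \<Rightarrow> 'a :: comm_ring_1)"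
  by standard auto

lemma ring_embedding_of_rat: "ring_embedding (of_rat :: rat \<Rightarrow> 'a :: field_char_0)"
  by standard (auto simp: of_rat_add of_rat_mult)

lemma poly_of_rat_int:
  "poly (map_poly of_rat (map_poly of_int P)) (x :: 'a :: field_char_0) = poly (map_poly of_int P) x"
  by (simp add: map_poly_map_poly o_def)

lemma poly_of_int_of_real:
  "poly (map_poly of_int P) (of_real x :: complex) = of_real (poly (map_poly of_int P) x)"
  by (induction P) (simp_all add: map_poly_pCons)

lemma complex_of_real_of_rat: "complex_of_real (of_rat r) = of_rat r"
  by (cases r) (simp add: of_rat_rat)

lemma poly_of_rat_of_real:
  "poly (map_poly of_rat P) (of_real x :: complex) = of_real (poly (map_poly of_rat P) x)"
  by (induction P) (simp_all add: map_poly_pCons complex_of_real_of_rat)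

text \<open>A nonzero polynomial \<open>d\<close> of least degree vanishing at \<open>x\<close>
  divides all others, by division with remainder. It divides the irreducible \<open>p\<close>
  without being a unit, so \<open>p\<close> divides \<open>d\<close> in turn.\<close>

lemma min_poly_dvd:
  fixes x :: "'a :: field_char_0"
  assumes p: "is_min_poly p x" and r: "poly (map_poly of_rat r) x = 0"
  shows "p dvd r"
proof -
  interpret R: ring_embedding "of_rat :: rat \<Rightarrow> 'a" by (rule ring_embedding_of_rat)
  define V where "V = (\<lambda>d :: rat poly. d \<noteq> 0 \<and> poly (map_poly of_rat d) x = 0)"
  have mod0: "poly (map_poly of_rat (a mod b)) x = 0"
    if "poly (map_poly of_rat a) x = 0" "poly (map_poly of_rat b) x = 0" for a b
  proof -
    have "a mod b = a - b * (a div b)" by (simp add: minus_mult_div_eq_mod)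
    then show ?thesis using that by (simp add: R.map_poly_diff R.map_poly_mult)
  qed
  have p0: "p \<noteq> 0" "poly (map_poly of_rat p) x = 0" "irreducible p"
    using p by (auto simp: is_min_poly_def)
  then have "\<exists>d. V d \<and> (\<forall>e. V e \<longrightarrow> degree d \<le> degree e)"
    by (intro ex_has_least_nat[of V p]) (simp add: V_def)
  then obtain d where d: "V d" "\<And>e. V e \<Longrightarrow> degree d \<le> degree e" by blast
  have dvd: "d dvd e" if "poly (map_poly of_rat e) x = 0" for e
  proof (rule ccontr)
    assume "\<not> d dvd e"
    then have "e mod d \<noteq> 0" by (simp add: dvd_eq_mod_eq_0)
    moreover have "degree (e mod d) < degree d"
      using degree_mod_less[of d e] \<open>e mod d \<noteq> 0\<close> d(1) by (auto simp: V_def)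
    ultimately show False using d mod0[of e d] that by (auto simp: V_def not_le[symmetric])
  qed
  then obtain s where s: "p = d * s" using p0 by (auto elim: dvdE)
  have "\<not> is_unit d"
  proof
    assume "is_unit d"
    then obtain c where "d = [:c:]" by (auto simp: is_unit_poly_iff)
    then show False using d(1) by (simp add: V_def map_poly_pCons)
  qed
  then have "is_unit s" using p0(3) s by (auto simp: irreducible_def)
  then have "p dvd d" using s by simp
  then show ?thesis using dvd[OF r] dvd_trans by blast
qed

lemma conjugate_poly_eq_0_iff:
  assumes "alg_conjugate x z"
  shows "poly (map_poly of_int P) x = 0 \<longleftrightarrow> poly (map_poly of_int P) z = 0"
proof -
  interpret R: ring_embedding "of_rat :: rat \<Rightarrow> complex" by (rule ring_embedding_of_rat)
  obtain p where p: "is_min_poly p x" "is_min_poly p z"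
    using assms by (auto simp: alg_conjugate_def is_min_poly_def)
  have "poly (map_poly of_int P) b = 0"
    if "poly (map_poly of_int P) a = 0" "is_min_poly p a" "is_min_poly p b" for a b :: complex
  proof -
    have "p dvd map_poly of_int P"
      by (rule min_poly_dvd[OF that(2)]) (simp add: poly_of_rat_int that(1))
    then obtain s where "map_poly of_int P = p * s" by (rule dvdE)
    then have "poly (map_poly of_int P) b = poly (map_poly of_rat (p * s)) b"
      using poly_of_rat_int[of P b] by simp
    then show ?thesis using that(3) by (simp add: R.map_poly_mult is_min_poly_def)
  qed
  then show ?thesis using p by blast
qed

lemma conjugate_poly_eq_0_iff_real:
  assumes "alg_conjugate (of_real x) z"
  shows "poly (map_poly of_int P) x = 0 \<longleftrightarrow> poly (map_poly of_int P) z = 0"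
  using conjugate_poly_eq_0_iff[OF assms, of P] by (simp add: poly_of_int_of_real)

section \<open>Translations of digit expansions\<close>

definition sumset :: "real set \<Rightarrow> real set \<Rightarrow> real set" where
  "sumset A B = (\<lambda>(a, b). a + b) ` (A \<times> B)"

lemma sumsetI: "a \<in> A \<Longrightarrow> b \<in> B \<Longrightarrow> a + b \<in> sumset A B"
  unfolding sumset_def by force

lemma finite_sumset: "finite A \<Longrightarrow> finite B \<Longrightarrow> finite (sumset A B)"
  unfolding sumset_def by simp

locale spectrum =
  fixes q :: real and m :: nat
  assumes q_gt_1: "q > 1" and m_pos: "m > 0"
begin

abbreviation Y where "Y \<equiv> Y_set m q"

text \<open>The value of \<open>m / q + m / q ^ 2 + ...\<close>, the largest that digits
  \<open>0..m\<close> can give, and the fixed point of \<open>t \<mapsto> q * t - m\<close>.\<close>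

definition L where "L = real m / (q - 1)"

lemma q_L: "q * L = L + real m"
  using q_gt_1 by (simp add: L_def field_simps)

lemma L_pos: "L > 0"
  using q_gt_1 m_pos by (simp add: L_def)

lemma Y_0: "0 \<in> Y"
  unfolding Y_set_def by (auto intro!: exI[of _ 0] exI[of _ "\<lambda>_. 0"])

lemma Y_step:
  assumes "y \<in> Y" "\<bar>c\<bar> \<le> int m"
  shows "q * y + of_int c \<in> Y"
proof -
  obtain n s where y: "y = (\<Sum>i\<le>n. of_int (s i) * q ^ i)" and s: "\<forall>i\<le>n. \<bar>s i\<bar> \<le> int m"
    using assms(1) unfolding Y_set_def by blast
  have "q * y + of_int c = (\<Sum>i\<le>Suc n. of_int (case_nat c s i) * q ^ i)"
    by (simp add: y sum.atMost_Suc_shift sum_distrib_left mult_ac del: sum.atMost_Suc)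
  moreover have "\<forall>i\<le>Suc n. \<bar>case_nat c s i\<bar> \<le> int m"
    using s assms(2) by (auto split: nat.split)
  ultimately show ?thesis
    unfolding Y_set_def by blast
qed

lemma Y_induct [consumes 1, case_names zero step]:
  assumes "y \<in> Y" and "P 0"
    and "\<And>y c. y \<in> Y \<Longrightarrow> P y \<Longrightarrow> \<bar>c\<bar> \<le> int m \<Longrightarrow> P (q * y + of_int c)"
  shows "P y"
proof -
  obtain n s where y: "y = (\<Sum>i\<le>n. of_int (s i) * q ^ i)" and s: "\<forall>i\<le>n. \<bar>s i\<bar> \<le> int m"
    using assms(1) unfolding Y_set_def by blast
  have "P (\<Sum>i\<le>n. of_int (s i) * q ^ i)"
    using s
  proof (induction n arbitrary: s)
    case 0
    then show ?case using assms(3)[OF Y_0 assms(2), of "s 0"] by simp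
  next
    case (Suc n)
    let ?y = "\<Sum>i\<le>n. of_int (s (Suc i)) * q ^ i"
    have "?y \<in> Y" using Suc.prems unfolding Y_set_def by fastforce
    moreover have "P ?y" using Suc by simp
    moreover have "(\<Sum>i\<le>Suc n. of_int (s i) * q ^ i) = q * ?y + of_int (s 0)"
      by (simp add: sum.atMost_Suc_shift sum_distrib_left mult_ac del: sum.atMost_Suc)
    ultimately show ?case using assms(3) Suc.prems by simp
  qed
  then show ?thesis by (simp add: y)
qed

lemma Y_int: "\<bar>c\<bar> \<le> int m \<Longrightarrow> of_int c \<in> Y"
  using Y_step[OF Y_0, of c] by simp

lemma Y_1: "1 \<in> Y"
  using Y_int[of 1] m_pos by simp

lemma Y_uminus: "y \<in> Y \<Longrightarrow> - y \<in> Y"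
proof (induction rule: Y_induct)
  case (step y c)
  then show ?case using Y_step[of "-y" "-c"] by simp
qed (simp add: Y_0)

text \<open>Integer parts with \<open>k\<close> digits from \<open>{..m}\<close>, leading digit
  first. \<open>Y\<close> consists of the differences of such numbers of equal length.\<close>

primrec X :: "nat \<Rightarrow> real set" where
  "X 0 = {0}"
| "X (Suc k) = (\<lambda>(u, c). q * u + real c) ` (X k \<times> {..m})"

lemma X_SucI: "u \<in> X k \<Longrightarrow> c \<le> m \<Longrightarrow> q * u + real c \<in> X (Suc k)"
  by force

lemma X_SucE:
  assumes "u \<in> X (Suc k)"
  obtains v c where "v \<in> X k" "c \<le> m" "u = q * v + real c"
  using assms by auto

lemma X_0: "0 \<in> X k"
  by (induction k) force+

lemma X_append: "u \<in> X j \<Longrightarrow> v \<in> X k \<Longrightarrow> q ^ k * u + v \<in> X (j + k)"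
proof (induction k arbitrary: v)
  case (Suc k)
  then obtain w c where "w \<in> X k" "c \<le> m" "v = q * w + real c"
    by (auto elim: X_SucE)
  then show ?case
    using X_SucI[of "q ^ k * u + w" "j + k" c] Suc by (simp add: algebra_simps)
qed auto

lemma X_mono: "u \<in> X k \<Longrightarrow> k \<le> n \<Longrightarrow> u \<in> X n"
  using X_append[OF X_0[of "n - k"], of u k] by simp

lemma Y_append: "y \<in> Y \<Longrightarrow> u \<in> X k \<Longrightarrow> v \<in> X k \<Longrightarrow> q ^ k * y + (u - v) \<in> Y"
proof (induction k arbitrary: u v)
  case (Suc k)
  obtain u' c where u: "u' \<in> X k" "c \<le> m" "u = q * u' + real c"
    using Suc by (auto elim: X_SucE)
  obtain v' d where v: "v' \<in> X k" "d \<le> m" "v = q * v' + real d"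
    using Suc by (auto elim: X_SucE)
  show ?case
    using Y_step[of "q ^ k * y + (u' - v')" "int c - int d"] Suc.IH[of u' v'] Suc.prems(1) u v
    by (simp add: algebra_simps)
qed auto

lemma X_diff_in_Y: "u \<in> X k \<Longrightarrow> v \<in> X k \<Longrightarrow> u - v \<in> Y"
  using Y_append[OF Y_0] by force

lemma Y_eq_X_diff:
  assumes "y \<in> Y"
  obtains k u v where "u \<in> X k" "v \<in> X k" "y = u - v"
proof -
  have "\<exists>k u v. u \<in> X k \<and> v \<in> X k \<and> y = u - v"
    using assms
  proof (induction rule: Y_induct)
    case zero
    then show ?case by (intro exI[of _ 0]) auto
  next
    case (step y c)
    then obtain k u v where *: "u \<in> X k" "v \<in> X k" "y = u - v" by blast
    have "q * u + real (nat c) \<in> X (Suc k)" "q * v + real (nat (- c)) \<in> X (Suc k)"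
      using * step.hyps(2) by (auto intro!: X_SucI simp del: X.simps)
    moreover have "q * y + of_int c = (q * u + real (nat c)) - (q * v + real (nat (- c)))"
      by (cases "c \<ge> 0") (simp_all add: *(3) algebra_simps)
    ultimately show ?case by blast
  qed
  then show ?thesis using that by blast
qed

lemma X_bounds: "u \<in> X k \<Longrightarrow> 0 \<le> u \<and> u \<le> q ^ k * L - L"
proof (induction k arbitrary: u)
  case (Suc k)
  then obtain v c where v: "v \<in> X k" "c \<le> m" "u = q * v + real c"
    by (auto elim: X_SucE)
  have "0 \<le> v" "v \<le> q ^ k * L - L" using Suc.IH v(1) by auto
  then have "q * v \<le> q * (q ^ k * L - L)" "0 \<le> q * v" using q_gt_1 by auto
  moreover have "real c \<le> real m" using v by simp
  ultimately show ?case using v q_L by (simp add: algebra_simps)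
qed (auto simp: L_pos)

text \<open>The integer part of \<open>t\<close>, capped at \<open>m\<close>. In the capped case
  \<open>t \<le> L + m\<close> keeps the remainder at most \<open>L\<close>.\<close>

lemma digit_exists:
  assumes "0 \<le> t" "t \<le> L + real m"
  obtains c where "c \<le> m" "0 \<le> t - real c" "c = m \<or> t - real c < 1" 
proof (cases "t < real m")
  case True
  have "real (nat \<lfloor>t\<rfloor>) \<le> t" "t < real (nat \<lfloor>t\<rfloor>) + 1"
    using assms by linarith+
  then show ?thesis using that[of "nat \<lfloor>t\<rfloor>"] True by linarith
next
  case False
  then show ?thesis using that[of m] by auto
qed

end

section \<open>Digit prefixes and shift errors in the overlapping case
  \<open>q < m + 1\<close>\<close>

locale spectrum_overlap = spectrum +
  assumes q_less: "q < real m + 1"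
begin

lemma L_gt_1: "L > 1"
  using q_gt_1 q_less by (simp add: L_def field_simps)

text \<open>\<open>u\<close> is what some expansion of \<open>s\<close> has read after
  \<open>k\<close> digits: a remainder in \<open>[0, L]\<close> can be expanded further. Expansions
  are not unique, so neither is \<open>u\<close>.\<close>

definition digit_prefix :: "nat \<Rightarrow> real \<Rightarrow> real \<Rightarrow> bool" where
  "digit_prefix k s u \<longleftrightarrow> u \<in> X k \<and> 0 \<le> q ^ k * s - u \<and> q ^ k * s - u \<le> L"

lemma digit_prefix_range:
  assumes "digit_prefix k s u" shows "0 \<le> s" "s \<le> L"
proof -
  have *: "u \<ge> 0" "u \<le> q ^ k * L - L" using assms X_bounds by (auto simp: digit_prefix_def)
  have p: "q ^ k > 0" using q_gt_1 by simp
  have "0 \<le> q ^ k * s" "q ^ k * s \<le> q ^ k * L"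
    using * assms by (auto simp: digit_prefix_def)
  then show "0 \<le> s" "s \<le> L" using p by (simp_all add: zero_le_mult_iff)
qed

lemma digit_prefix_exists:
  assumes "0 \<le> s" "s \<le> L"
  obtains u where "digit_prefix k s u"
proof -
  have "\<exists>u. digit_prefix k s u"
  proof (induction k)
    case 0
    then show ?case using assms by (auto simp: digit_prefix_def)
  next
    case (Suc k)
    then obtain u where u: "digit_prefix k s u" by blast
    define t where "t = q * (q ^ k * s - u)"
    have t: "0 \<le> t" "t \<le> L + real m"
      using u q_gt_1 by (auto simp: t_def digit_prefix_def q_L[symmetric])
    obtain c where c: "c \<le> m" "0 \<le> t - real c" "c = m \<or> t - real c < 1"
      using digit_exists[OF t] .
    have "digit_prefix (Suc k) s (q * u + real c)"
      unfolding digit_prefix_def using X_SucI[of u k c] u c t L_gt_1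
      by (auto simp: digit_prefix_def t_def algebra_simps)
    then show ?case by blast
  qed
  then show ?thesis using that by blast
qed

text \<open>Two readings of equal length differ by an element of \<open>Y\<close>, and both
  remainders lie in \<open>[0, L]\<close>.\<close>

lemma digit_prefix_split:
  assumes "digit_prefix (j + k) s u" "w \<in> X j" "digit_prefix k (q ^ j * s - w) v"
  shows "u - (q ^ k * w + v) \<in> Y \<inter> {-L..L}"
proof -
  have "q ^ k * w + v \<in> X (j + k)" using assms by (auto intro: X_append simp: digit_prefix_def)
  then have "u - (q ^ k * w + v) \<in> Y" using assms by (auto intro: X_diff_in_Y simp: digit_prefix_def)
  moreover have "u - (q ^ k * w + v) = (q ^ k * (q ^ j * s - w) - v) - (q ^ (j + k) * s - u)"
    by (simp add: algebra_simps power_add)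
  then have "u - (q ^ k * w + v) \<in> {-L..L}" using assms unfolding digit_prefix_def by auto
  ultimately show ?thesis by blast
qed

text \<open>If \<open>k\<close> digits of \<open>s\<close> and of \<open>s + d\<close> have been read, then the integer parts \<open>u\<close>, \<open>u'\<close> of
  \<open>q ^ k * s\<close>, \<open>q ^ k * (s + d)\<close> differ from the expected shift \<open>q ^ k * d\<close> by a bounded error.
  The shift \<open>d\<close> is useful when only finitely many errors occur for all \<open>s\<close> and \<open>k\<close> together.\<close>
definition shift_errors :: "real \<Rightarrow> real set" where
  "shift_errors d = {u' - u - q ^ k * d | k u u' s. digit_prefix k s u \<and> digit_prefix k (s + d) u'}"

lemma shift_errors_memI: "digit_prefix k s u \<Longrightarrow> digit_prefix k s' u' \<Longrightarrow> s' = s + d \<Longrightarrow> u' - u - q ^ k * d \<in> shift_errors d"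
  unfolding shift_errors_def by blast

lemma shift_errors_memE:
  assumes "x \<in> shift_errors d"
  obtains k u u' s where "digit_prefix k s u" "digit_prefix k (s + d) u'" "x = u' - u - q ^ k * d"
  using assms unfolding shift_errors_def by blast

lemma shift_errors_uminus: "shift_errors (- d) = uminus ` shift_errors d"
proof -
  have *: "uminus ` shift_errors d \<subseteq> shift_errors (- d)" for d
  proof
    fix x assume "x \<in> uminus ` shift_errors d"
    then obtain k u u' s where *: "digit_prefix k s u" "digit_prefix k (s + d) u'" "x = - (u' - u - q ^ k * d)"
      unfolding shift_errors_def by blast
    have "u - u' - q ^ k * (- d) \<in> shift_errors (- d)"
      by (rule shift_errors_memI[OF *(2,1)]) simp
    also have "u - u' - q ^ k * (- d) = x" using * by simp
    finally show "x \<in> shift_errors (- d)" .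
  qed
  have "shift_errors (- d) = uminus ` uminus ` shift_errors (- d)" by (auto simp: image_image)
  also have "\<dots> \<subseteq> uminus ` shift_errors d" using *[of "- d"] by auto
  finally show ?thesis using * by blast
qed

text \<open>The error is a difference of two remainders, hence bounded, and it is \<open>- y\<close>
  continued by digit differences, hence in \<open>Y\<close>. Local finiteness then leaves finitely
  many errors.\<close>

lemma shift_errors_Y: "y \<in> Y \<Longrightarrow> shift_errors y \<subseteq> Y \<inter> {-L..L}"
proof
  fix x assume y: "y \<in> Y" and "x \<in> shift_errors y"
  then obtain k u u' s where *: "digit_prefix k s u" "digit_prefix k (s + y) u'" "x = u' - u - q ^ k * y"
    by (auto elim: shift_errors_memE)
  have "x = q ^ k * (- y) + (u' - u)" by (simp add: *)
  then have "x \<in> Y" using Y_append[OF Y_uminus[OF y]] * by (auto simp: digit_prefix_def)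
  moreover have "x = (q ^ k * s - u) - (q ^ k * (s + y) - u')" by (simp add: * algebra_simps)
  then have "x \<in> {-L..L}" using * unfolding digit_prefix_def by auto
  ultimately show "x \<in> Y \<inter> {-L..L}" by blast
qed

text \<open>The shift is routed through \<open>s + a\<close> or \<open>s - b\<close>; by
  \<open>a + b \<le> L\<close> at least one of them stays in \<open>[0, L]\<close>, and the errors
  of the two halves add up.\<close>

lemma shift_errors_diff:
  assumes "0 \<le> a" "0 \<le> b" "a + b \<le> L"
  shows "shift_errors (a - b) \<subseteq> sumset (shift_errors a) (shift_errors (- b))"
proof
  fix x assume "x \<in> shift_errors (a - b)"
  then obtain k u u' s where *: "digit_prefix k s u" "digit_prefix k (s + (a - b)) u'" "x = u' - u - q ^ k * (a - b)"
    by (auto elim: shift_errors_memE)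
  note r = digit_prefix_range[OF *(1)] digit_prefix_range[OF *(2)]
  show "x \<in> sumset (shift_errors a) (shift_errors (- b))"
  proof (cases "s + a \<le> L")
    case True
    then obtain w where w: "digit_prefix k (s + a) w" using digit_prefix_exists[of "s + a" k] r assms by auto
    have "x = (w - u - q ^ k * a) + (u' - w - q ^ k * (- b))" by (simp add: * algebra_simps)
    also have "\<dots> \<in> sumset (shift_errors a) (shift_errors (- b))"
      using w * by (intro sumsetI shift_errors_memI[where s = s and s' = "s + a"]
          shift_errors_memI[where s = "s + a" and s' = "s + (a - b)"]) auto
    finally show ?thesis .
  next
    case False
    then obtain w where w: "digit_prefix k (s - b) w" using digit_prefix_exists[of "s - b" k] r assms by auto
    have "x = (u' - w - q ^ k * a) + (w - u - q ^ k * (- b))" by (simp add: * algebra_simps)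
    also have "\<dots> \<in> sumset (shift_errors a) (shift_errors (- b))"
      using w * by (intro sumsetI shift_errors_memI[where s = "s - b" and s' = "s + (a - b)"]
          shift_errors_memI[where s = s and s' = "s - b"]) auto
    finally show ?thesis .
  qed
qed

text \<open>When \<open>s\<close> and \<open>s + h / q\<close> admit no common first digit, they admit first digits that differ by
  one, and the remainders then differ by \<open>h - 1\<close>.\<close>
lemma shift_errors_divide:
  assumes h: "0 \<le> h" "h \<le> 1"
  shows "shift_errors (h / q) \<subseteq> insert (- (h / q))
    (sumset (sumset (Y \<inter> {-L..L}) (Y \<inter> {-L..L})) (shift_errors h \<union> shift_errors (h - 1)))"
proof
  fix x assume "x \<in> shift_errors (h / q)"
  then obtain k u u' s where *: "digit_prefix k s u" "digit_prefix k (s + h / q) u'" "x = u' - u - q ^ k * (h / q)"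
    by (auto elim: shift_errors_memE)
  note r = digit_prefix_range[OF *(1)] digit_prefix_range[OF *(2)]
  show "x \<in> insert (- (h / q)) (sumset (sumset (Y \<inter> {-L..L}) (Y \<inter> {-L..L})) (shift_errors h \<union> shift_errors (h - 1)))"
  proof (cases k)
    \<comment> \<open>No digit has been read, so \<open>u = u' = 0\<close>; this is the inserted
      element.\<close>
    case 0
    then show ?thesis using * by (auto simp: digit_prefix_def)
  next
    case (Suc n)
    define t where "t = q * s"
    have t: "0 \<le> t" "t + h \<le> L + real m"
    proof -
      show "0 \<le> t" using r q_gt_1 by (simp add: t_def)
      have "q * (s + h / q) \<le> q * L" using r q_gt_1 by (intro mult_left_mono) auto
      then show "t + h \<le> L + real m" using q_gt_1 q_L by (simp add: t_def algebra_simps)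
    qed
    obtain c where c: "c \<le> m" "0 \<le> t - real c" "c = m \<or> t - real c < 1"
      using digit_exists[of t] t h by auto
    have "\<exists>c'\<le>m. (c' = c \<or> c' = c + 1) \<and> 0 \<le> t + h - real c' \<and> t + h - real c' \<le> L"
    proof (cases "t + h - real c \<le> L")
      case True
      then show ?thesis using c h by (intro exI[of _ c]) auto
    next
      case False
      \<comment> \<open>The digit \<open>c\<close> is not capped, so \<open>t - c < 1\<close>, and
        the digit \<open>c + 1\<close> leaves a remainder between \<open>L - 1\<close> and
        \<open>h\<close>.\<close>
      then have "c \<noteq> m" using t by auto
      then show ?thesis using c h False L_gt_1 by (intro exI[of _ "c + 1"]) auto
    qed
    then obtain c' where c': "c' \<le> m" "c' = c \<or> c' = c + 1" "0 \<le> t + h - real c'" "t + h - real c' \<le> L"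
      by blast
    obtain v where v: "digit_prefix n (t - real c) v" using digit_prefix_exists[of "t - real c" n] c t L_gt_1 h by fastforce
    obtain v' where v': "digit_prefix n (t + h - real c') v'" using digit_prefix_exists c' by blast
    have X1: "real d \<in> X 1" if "d \<le> m" for d
      using X_SucI[of 0 0 d] that by simp
    have d: "u - (q ^ n * real c + v) \<in> Y \<inter> {-L..L}"
      using digit_prefix_split[of 1 n s u "real c" v] * v X1 c Suc by (simp add: t_def)
    have d': "u' - (q ^ n * real c' + v') \<in> Y \<inter> {-L..L}"
    proof -
      have "q ^ 1 * (s + h / q) - real c' = t + h - real c'"
        using q_gt_1 by (simp add: t_def field_simps)
      then show ?thesis
        using digit_prefix_split[of 1 n "s + h / q" u' "real c'" v'] * v' X1 c' Suc by simp
    qed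
    define d1 where "d1 = h + real c - real c'"
    have "d1 = h \<or> d1 = h - 1" using c' by (auto simp: d1_def)
    moreover have "v' - v - q ^ n * d1 \<in> shift_errors d1"
      by (rule shift_errors_memI[OF v v']) (simp add: d1_def)
    ultimately have e: "v' - v - q ^ n * d1 \<in> shift_errors h \<union> shift_errors (h - 1)" by auto
    have "x = ((u' - (q ^ n * real c' + v')) + - (u - (q ^ n * real c + v))) + (v' - v - q ^ n * d1)"
      using q_gt_1 Suc by (simp add: *(3) d1_def algebra_simps)
    also have "\<dots> \<in> sumset (sumset (Y \<inter> {-L..L}) (Y \<inter> {-L..L})) (shift_errors h \<union> shift_errors (h - 1))"
      using d d' e by (intro sumsetI) (auto dest: Y_uminus)
    finally show ?thesis by blast
  qed
qed

text \<open>The first \<open>j\<close> digits are chosen for the shift \<open>h / q\<close>, then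
  one more follows. An uncapped digit leaves a remainder below 1, and \<open>1 + h \<le> L\<close>;
  for the digit \<open>m\<close> there is room because \<open>t + h \<le> L + m\<close>.\<close>

lemma common_prefix:
  assumes "0 \<le> h" "h \<le> L - 1" "0 \<le> s" "s + h / q ^ j \<le> L"
  shows "\<exists>w\<in>X j. 0 \<le> q ^ j * s - w \<and> q ^ j * s - w + h \<le> L"
  using assms
proof (induction j arbitrary: h)
  case 0
  then show ?case by auto
next
  case (Suc j)
  have "h / q \<le> h" using Suc q_gt_1 by (simp add: divide_le_eq mult_le_cancel_left1)
  then have "0 \<le> h / q" "h / q \<le> L - 1" using Suc q_gt_1 by auto
  then obtain w where w: "w \<in> X j" "0 \<le> q ^ j * s - w" "q ^ j * s - w + h / q \<le> L"
    using Suc.IH[of "h / q"] Suc.prems by (auto simp: field_simps)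
  define t where "t = q * (q ^ j * s - w)"
  have "0 \<le> t" using w q_gt_1 by (simp add: t_def)
  have "q * (q ^ j * s - w + h / q) \<le> q * L" using w q_gt_1 by (intro mult_left_mono) auto
  then have th: "t + h \<le> L + real m" using q_gt_1 q_L by (simp add: t_def algebra_simps)
  obtain c where c: "c \<le> m" "0 \<le> t - real c" "c = m \<or> t - real c < 1"
    using digit_exists[of t] \<open>0 \<le> t\<close> th Suc.prems by auto
  have "q * w + real c \<in> X (Suc j)" using w c by (intro X_SucI)
  moreover have "t - real c + h \<le> L" using c th Suc.prems by auto
  ultimately show ?case using c by (intro bexI[of _ "q * w + real c"]) (auto simp: t_def algebra_simps)
qed

text \<open>A shift \<open>h\<close> not longer than the overlap \<open>L - 1\<close> of neighbouring cylinders fits into a common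
  cylinder at every scale, so that one finite set serves for all \<open>h / q ^ j\<close>.\<close>
lemma uniform_errors:
  assumes h: "0 \<le> h" "h \<le> L - 1" and y: "y \<in> Y" and yh: "\<bar>y - q ^ i * h\<bar> \<le> L"
  shows "y - q ^ i * h \<in> sumset (sumset (Y \<inter> {-L..L}) (Y \<inter> {-L..L})) (shift_errors h)"
proof -
  obtain k0 u0 v0 where "u0 \<in> X k0" "v0 \<in> X k0" "y = u0 - v0"
    using y by (rule Y_eq_X_diff)
  then obtain j u' u where u: "u' \<in> X (j + i)" "u \<in> X (j + i)" "y = u' - u"
    using X_mono[of _ k0 "k0 + i"] by fastforce
  define e where "e = y - q ^ i * h"
  \<comment> \<open>The positive and negative parts of the error serve as remainders:
    \<open>s\<close> and \<open>s'\<close> then have the prefixes \<open>u\<close> and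
    \<open>u'\<close> and differ by exactly \<open>h / q ^ j\<close>.\<close>
  define t where "t = max e 0"
  define t' where "t' = max (- e) 0"
  have t: "0 \<le> t" "t \<le> L" "0 \<le> t'" "t' \<le> L" "t - t' = e"
    using yh L_pos by (auto simp: t_def t'_def e_def)
  define s where "s = (u + t) / q ^ (j + i)"
  define s' where "s' = (u' + t') / q ^ (j + i)"
  have digit_prefix: "digit_prefix (j + i) s u" "digit_prefix (j + i) s' u'"
    using t u q_gt_1 by (simp_all add: digit_prefix_def s_def s'_def)
  note r = digit_prefix_range[OF digit_prefix(1)] digit_prefix_range[OF digit_prefix(2)]
  have "s' - s = (u' - u + (t' - t)) / q ^ (j + i)"
    by (simp add: s_def s'_def diff_divide_distrib add_divide_distrib)
  also have "\<dots> = q ^ i * h / q ^ (j + i)" using t u by (simp add: e_def)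
  also have "\<dots> = h / q ^ j" using q_gt_1 by (simp add: power_add)
  finally have s': "s' = s + h / q ^ j" by simp
  obtain w where w: "w \<in> X j" "0 \<le> q ^ j * s - w" "q ^ j * s - w + h \<le> L"
    using common_prefix[OF h, of s j] r s' by auto
  define s1 where "s1 = q ^ j * s - w"
  have s1': "q ^ j * s' - w = s1 + h" using q_gt_1 by (simp add: s1_def s' field_simps)
  obtain v where v: "digit_prefix i s1 v" using digit_prefix_exists[of s1 i] w h by (auto simp: s1_def)
  obtain v' where v': "digit_prefix i (s1 + h) v'" using digit_prefix_exists[of "s1 + h" i] w h by (auto simp: s1_def)
  have d: "u - (q ^ i * w + v) \<in> Y \<inter> {-L..L}"
    using digit_prefix_split[OF digit_prefix(1) w(1)] v by (simp add: s1_def)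
  have d': "u' - (q ^ i * w + v') \<in> Y \<inter> {-L..L}"
    using digit_prefix_split[OF digit_prefix(2) w(1)] v' s1' by simp
  have e: "v' - v - q ^ i * h \<in> shift_errors h" using shift_errors_memI[OF v v'] by simp
  have "y - q ^ i * h = ((u' - (q ^ i * w + v')) + - (u - (q ^ i * w + v))) + (v' - v - q ^ i * h)"
    by (simp add: u(3))
  also have "\<dots> \<in> sumset (sumset (Y \<inter> {-L..L}) (Y \<inter> {-L..L})) (shift_errors h)"
    using d d' e by (intro sumsetI) (auto dest: Y_uminus)
  finally show ?thesis .
qed

end

section \<open>Small translations with uniformly finite errors\<close>

text \<open>The Euclidean algorithm: as long as both numbers exceed \<open>\<epsilon>\<close>, a subtraction lowers
  their sum by more than \<open>\<epsilon>\<close>, and incommensurability keeps them different.\<close>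
lemma euclid_small:
  fixes S :: "real set"
  assumes S: "\<And>a b. a \<in> S \<Longrightarrow> b \<in> S \<Longrightarrow> 0 < b \<Longrightarrow> b < a \<Longrightarrow> a + b \<le> M \<Longrightarrow> a - b \<in> S"
    and \<epsilon>: "\<epsilon> > 0"
    and x: "x \<in> S" "x > 0" and y: "y \<in> S" "y > 0" and xy: "x / y \<notin> \<rat>" "x + y \<le> M"
  shows "\<exists>h\<in>S. 0 < h \<and> h \<le> \<epsilon>"
proof -
  have "\<exists>h\<in>S. 0 < h \<and> h \<le> \<epsilon>"
    if "x \<in> S" "x > 0" "y \<in> S" "y > 0" "x / y \<notin> \<rat>" "x + y \<le> M" "x + y \<le> real n * \<epsilon>" for n x y
    using that
  proof (induction n arbitrary: x y)
    case (Suc n)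
    show ?case
    proof (cases "x \<le> \<epsilon> \<or> y \<le> \<epsilon>")
      case False
      show ?thesis
      proof (cases "y < x")
        case True
        have "x / y = (x - y) / y + 1" using Suc by (simp add: field_simps)
        then have "(x - y) / y \<notin> \<rat>" using Suc.prems(5) by (metis Rats_1 Rats_add)
        then show ?thesis
          using Suc.IH[of "x - y" y] Suc.prems S[of x y] True False by (auto simp: algebra_simps)
      next
        case F: False
        have "x \<noteq> y" using Suc.prems by auto
        then have "x < y" using F by simp
        have "y / x = (y - x) / x + 1" using Suc by (simp add: field_simps)
        moreover have "y / x \<notin> \<rat>"
          using Suc.prems(5) by (metis Rats_inverse inverse_divide)
        ultimately have "(y - x) / x \<notin> \<rat>" by (metis Rats_1 Rats_add)
        then have "x / (y - x) \<notin> \<rat>" by (metis Rats_inverse inverse_divide)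
        then show ?thesis
          using Suc.IH[of x "y - x"] Suc.prems S[of y x] \<open>x < y\<close> False by (auto simp: algebra_simps)
      qed
    qed (use Suc in blast)
  qed simp
  moreover obtain n where "x + y \<le> real n * \<epsilon>"
    using \<epsilon> reals_Archimedean3[of \<epsilon>] less_imp_le by meson
  ultimately show ?thesis using x y xy by blast
qed

context spectrum_overlap
begin

text \<open>\<open>S\<close> contains \<open>a\<close> since \<open>a \<in> Y\<close>, and
  \<open>a / q\<close> since also \<open>1 - a \<in> Y\<close>. Their ratio \<open>q\<close> is
  irrational, so the Euclidean algorithm inside \<open>S\<close> gets below the overlap
  \<open>L - 1\<close>.\<close>

lemma uniform_shift_exists:
  assumes fin: "\<And>R. finite (Y \<inter> {-R..R})"
    and irr: "q \<notin> \<rat>" and a: "0 < a" "a \<le> 1 / 2" "a \<in> Y" "1 - a \<in> Y"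
  obtains A B :: int and h where "h = of_int A * a + of_int B * (a / q)" "h > 0"
    "finite (\<Union>i. {y - q ^ i * h | y. y \<in> Y \<and> \<bar>y - q ^ i * h\<bar> \<le> L})"
proof -
  define S where "S = {h. finite (shift_errors h) \<and> (\<exists>A B :: int. h = of_int A * a + of_int B * (a / q))}"
  have finY: "finite (shift_errors y)" if "y \<in> Y" for y
    using shift_errors_Y[OF that] fin[of L] finite_subset by blast
  have finm: "finite (shift_errors (- d))" if "finite (shift_errors d)" for d
    using that by (simp add: shift_errors_uminus)
  have Sdiff: "x - y \<in> S" if xy: "x \<in> S" "y \<in> S" "0 < y" "y < x" "x + y \<le> L" for x y
  proof -
    have "finite (shift_errors (x - y))"
      using shift_errors_diff[of x y] xy finm finite_sumset finite_subset unfolding S_def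
      by (smt (verit, best) mem_Collect_eq)
    moreover obtain A B :: int where "x = of_int A * a + of_int B * (a / q)" using xy by (auto simp: S_def)
    moreover obtain C D :: int where "y = of_int C * a + of_int D * (a / q)" using xy by (auto simp: S_def)
    ultimately have "finite (shift_errors (x - y))" "x - y = of_int (A - C) * a + of_int (B - D) * (a / q)"
      by (simp_all add: algebra_simps diff_divide_distrib)
    then show ?thesis unfolding S_def by blast
  qed
  have "finite (shift_errors (a / q))"
  proof (rule finite_subset[OF shift_errors_divide])
    have "finite (shift_errors (a - 1))" using finm[OF finY[OF a(4)]] by simp
    then show "finite (insert (- (a / q)) (sumset (sumset (Y \<inter> {- L..L}) (Y \<inter> {- L..L})) (shift_errors a \<union> shift_errors (a - 1))))"
      using finY[OF a(3)] fin[of L] by (simp add: finite_sumset)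
  qed (use a in auto)
  moreover have "a / q = of_int 0 * a + of_int 1 * (a / q)" "a = of_int 1 * a + of_int 0 * (a / q)"
    by simp_all
  ultimately have "a / q \<in> S" "a \<in> S" using finY[OF a(3)] unfolding S_def by blast+
  moreover have "a / (a / q) \<notin> \<rat>" using irr a by simp
  moreover have "a + a / q \<le> L"
  proof -
    have "a / q \<le> a" using q_gt_1 a by (simp add: divide_le_eq)
    then show ?thesis using a L_gt_1 by linarith
  qed
  ultimately obtain h where h: "h \<in> S" "0 < h" "h \<le> L - 1"
    using euclid_small[of S L "L - 1" a "a / q"] Sdiff a q_gt_1 L_gt_1 by auto
  obtain A B where AB: "h = of_int A * a + of_int B * (a / q)" "finite (shift_errors h)"
    using h by (auto simp: S_def)
  have "finite (\<Union>i. {y - q ^ i * h | y. y \<in> Y \<and> \<bar>y - q ^ i * h\<bar> \<le> L})"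
  proof (rule finite_subset)
    show "finite (sumset (sumset (Y \<inter> {-L..L}) (Y \<inter> {-L..L})) (shift_errors h))"
      using fin AB by (simp add: finite_sumset)
    show "(\<Union>i. {y - q ^ i * h | y. y \<in> Y \<and> \<bar>y - q ^ i * h\<bar> \<le> L})
        \<subseteq> sumset (sumset (Y \<inter> {-L..L}) (Y \<inter> {-L..L})) (shift_errors h)"
      using uniform_errors[of h] h by auto
  qed
  then show ?thesis using that AB h by blast
qed

section \<open>The expansion of 1 with all digits equal to \<open>m\<close>\<close>

definition horner :: "nat \<Rightarrow> real" where
  "horner k = ((\<lambda>y. q * y - real m) ^^ k) 1"

lemma horner_0 [simp]: "horner 0 = 1"
  by (simp add: horner_def)

lemma horner_Suc: "horner (Suc k) = q * horner k - real m"
  by (simp add: horner_def)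

text \<open>The map \<open>y \<mapsto> q * y - m\<close> repels from its fixed point
  \<open>L\<close>, and the start 1 lies below \<open>L\<close>.\<close>

lemma horner_eq: "horner k = L - q ^ k * (L - 1)"
proof (induction k)
  case (Suc k)
  have "q * (L - q ^ k * (L - 1)) = q * L - q ^ Suc k * (L - 1)" by (simp add: algebra_simps)
  then show ?case using Suc by (simp add: horner_Suc q_L)
qed simp

lemma horner_decreasing: "horner (Suc k) < horner k"
  using L_gt_1 q_gt_1 by (simp add: horner_eq)

lemma horner_in_Y: "horner k \<in> Y"
proof (induction k)
  case (Suc k)
  then show ?case using Y_step[of _ "- int m"] by (simp add: horner_Suc)
qed (simp add: Y_1)

lemma horner_last_positive:
  obtains k where "horner (Suc k) \<le> 0" "\<And>j. j \<le> k \<Longrightarrow> horner j > 0"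
proof -
  obtain n where "L / (L - 1) < q ^ n" using real_arch_pow[OF q_gt_1] by blast
  then have n: "horner n \<le> 0" using L_gt_1 by (simp add: horner_eq field_simps)
  define N where "N = (LEAST n. horner n \<le> 0)"
  have N: "horner N \<le> 0" unfolding N_def using n by (rule LeastI)
  then obtain k where k: "N = Suc k" by (cases N) auto
  have "horner j > 0" if "j \<le> k" for j
    using not_less_Least[of j "\<lambda>n. horner n \<le> 0"] that k by (auto simp: N_def[symmetric] not_le)
  then show ?thesis using that N k by auto
qed

text \<open>Let \<open>k\<close> be the last index with \<open>horner k > 0\<close> and \<open>r\<close> the fractional part of \<open>q * horner k\<close>.
  Either \<open>r = 0\<close>, or both \<open>r\<close> and \<open>1 - r\<close> belong to the spectrum.\<close>
lemma dichotomy: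
  obtains (simple) k s where "s \<in> {1..m}" "q * horner k = real s" "\<And>j. j \<le> k \<Longrightarrow> horner j > 0"
  | (overlap) a where "0 < a" "a \<le> 1 / 2" "a \<in> Y" "1 - a \<in> Y"
proof -
  obtain k where k: "horner (Suc k) \<le> 0" "\<And>j. j \<le> k \<Longrightarrow> horner j > 0"
    using horner_last_positive by blast
  define t where "t = q * horner k"
  have t: "0 < t" "t \<le> real m"
    using k q_gt_1 by (auto simp: t_def horner_Suc)
  define s where "s = nat \<lfloor>t\<rfloor>"
  have s: "real s \<le> t" "t < real s + 1" using t unfolding s_def by linarith+
  show ?thesis
  proof (cases "t = real s")
    case True
    then show ?thesis using simple[of s k] t k by (auto simp: t_def)
  next
    case False
    \<comment> \<open>As \<open>s < t \<le> m\<close>, the digit \<open>s + 1\<close> is admissible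
      too; it gives the negative of \<open>1 - (t - s)\<close>.\<close>
    then have sm: "s + 1 \<le> m" using s t by linarith
    have r: "t - real s \<in> Y" "1 - (t - real s) \<in> Y"
    proof -
      show "t - real s \<in> Y"
        using Y_step[OF horner_in_Y[of k], of "- int s"] sm by (simp add: t_def)
      have "t - real (s + 1) \<in> Y"
        using Y_step[OF horner_in_Y[of k], of "- int (s + 1)"] sm by (simp add: t_def add_diff_eq diff_diff_eq)
      from Y_uminus[OF this] show "1 - (t - real s) \<in> Y" by (simp add: algebra_simps)
    qed
    show ?thesis
    proof (cases "t - real s \<le> 1 / 2")
      case True
      then show ?thesis using overlap[of "t - real s"] r s False by auto
    next
      case F: False
      show ?thesis using overlap[of "1 - (t - real s)"] r s F by auto
    qed
  qed
qed

end

section \<open>Conjugates of modulus at least one\<close>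

text \<open>Having the same integer annihilators makes \<open>P(q) \<mapsto> P(z)\<close> a
  well-defined isomorphism from \<open>Z[q]\<close> to \<open>Z[z]\<close>.\<close>

locale conjugate_pair = spectrum +
  fixes z :: complex
  assumes conj: "\<And>P :: int poly. poly (map_poly of_int P) q = 0 \<longleftrightarrow> poly (map_poly of_int P) z = 0"
begin

interpretation IR: ring_embedding "of_int :: int \<Rightarrow> real" by (rule ring_embedding_of_int)
interpretation IC: ring_embedding "of_int :: int \<Rightarrow> complex" by (rule ring_embedding_of_int)

definition Zq :: "real set" where
  "Zq = range (\<lambda>P :: int poly. poly (map_poly of_int P) q)"

text \<open>This isomorphism, defined by choice; its values are meaningful on \<open>Zq\<close>
  only.\<close>

definition conj_map :: "real \<Rightarrow> complex" where
  "conj_map y = (SOME w. \<exists>P :: int poly. y = poly (map_poly of_int P) q \<and> w = poly (map_poly of_int P) z)"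

lemma conj_map_poly: "conj_map (poly (map_poly of_int P) q) = poly (map_poly of_int P) z"
proof -
  have "\<exists>Q :: int poly. poly (map_poly of_int P) q = poly (map_poly of_int Q) q \<and>
      conj_map (poly (map_poly of_int P) q) = poly (map_poly of_int Q) z"
    unfolding conj_map_def by (rule someI_ex) blast
  then obtain Q :: "int poly" where Q: "poly (map_poly of_int P) q = poly (map_poly of_int Q) q"
    "conj_map (poly (map_poly of_int P) q) = poly (map_poly of_int Q) z" by blast
  then have "poly (map_poly of_int (P - Q)) z = 0"
    by (subst conj[symmetric]) (simp add: IR.map_poly_diff)
  then show ?thesis using Q by (simp add: IC.map_poly_diff)
qed

lemma Zq_cases:
  assumes "y \<in> Zq"
  obtains P where "y = poly (map_poly of_int P) q" "conj_map y = poly (map_poly of_int P) z"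
  using assms conj_map_poly unfolding Zq_def by blast

lemma conj_map_add: "x \<in> Zq \<Longrightarrow> y \<in> Zq \<Longrightarrow> x + y \<in> Zq \<and> conj_map (x + y) = conj_map x + conj_map y"
proof (elim Zq_cases)
  fix P Q assume "x = poly (map_poly of_int P) q" "conj_map x = poly (map_poly of_int P) z"
    "y = poly (map_poly of_int Q) q" "conj_map y = poly (map_poly of_int Q) z"
  then show ?thesis
    using conj_map_poly[of "P + Q"] unfolding Zq_def
    by (auto simp: IR.map_poly_add IC.map_poly_add intro!: image_eqI[of _ _ "P + Q"])
qed

lemma conj_map_diff: "x \<in> Zq \<Longrightarrow> y \<in> Zq \<Longrightarrow> x - y \<in> Zq \<and> conj_map (x - y) = conj_map x - conj_map y"
proof (elim Zq_cases)
  fix P Q assume "x = poly (map_poly of_int P) q" "conj_map x = poly (map_poly of_int P) z"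
    "y = poly (map_poly of_int Q) q" "conj_map y = poly (map_poly of_int Q) z"
  then show ?thesis
    using conj_map_poly[of "P - Q"] unfolding Zq_def
    by (auto simp: IR.map_poly_diff IC.map_poly_diff intro!: image_eqI[of _ _ "P - Q"])
qed

lemma conj_map_step: "y \<in> Zq \<Longrightarrow> q * y + of_int c \<in> Zq \<and> conj_map (q * y + of_int c) = z * conj_map y + of_int c"
proof (elim Zq_cases)
  fix P assume "y = poly (map_poly of_int P) q" "conj_map y = poly (map_poly of_int P) z"
  then show ?thesis
    using conj_map_poly[of "pCons c P"] unfolding Zq_def
    by (auto simp: map_poly_pCons add.commute intro!: image_eqI[of _ _ "pCons c P"])
qed

lemma conj_map_of_int: "of_int c \<in> Zq \<and> conj_map (of_int c) = of_int c"
  using conj_map_poly[of "[:c:]"] unfolding Zq_def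
  by (auto simp: map_poly_pCons intro!: image_eqI[of _ _ "[:c:]"])

lemma conj_map_mult_power: "y \<in> Zq \<Longrightarrow> q ^ i * y \<in> Zq \<and> conj_map (q ^ i * y) = z ^ i * conj_map y"
proof (induction i)
  case (Suc i)
  then show ?case using conj_map_step[of "q ^ i * y" 0] by (simp add: mult.assoc)
qed simp

lemma conj_map_eq_0_iff: "y \<in> Zq \<Longrightarrow> conj_map y = 0 \<longleftrightarrow> y = 0"
  by (elim Zq_cases) (simp add: conj)

lemma Y_subset_Zq: "y \<in> Y \<Longrightarrow> y \<in> Zq"
proof (induction rule: Y_induct)
  case zero
  then show ?case using conj_map_of_int[of 0] by simp
next
  case (step y c)
  then show ?case using conj_map_step[of y c] by simp
qed

lemma conj_map_Y_step: "y \<in> Y \<Longrightarrow> conj_map (q * y + of_int c) = z * conj_map y + of_int c"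
  using conj_map_step Y_subset_Zq by blast

end

section \<open>Equality in the triangle inequality and simultaneous limits\<close>

lemma Re_eq_norm_imp_eq:
  fixes w :: complex
  assumes "norm w \<le> r" "Re w \<ge> r"
  shows "w = of_real r"
proof -
  have "Re w = r" using assms complex_Re_le_cmod[of w] by linarith
  moreover have "(Re w)\<^sup>2 + (Im w)\<^sup>2 \<le> r\<^sup>2"
    using assms by (simp add: cmod_power2[symmetric] power_mono)
  ultimately have "Im w = 0" by simp
  then show ?thesis using \<open>Re w = r\<close> by (simp add: complex_eq_iff)
qed

text \<open>The deficits \<open>g\<close> in the direction of \<open>w\<close> are nonnegative and
  sum to zero, so each vanishes; with the bound on \<open>norm (v i)\<close> this fixes
  \<open>v i\<close> itself.\<close>

lemma equality_in_weighted_sum: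
  fixes v :: "'i \<Rightarrow> complex" and l :: "'i \<Rightarrow> real"
  assumes "finite I" "\<And>i. i \<in> I \<Longrightarrow> norm (v i) \<le> norm w * l i"
    and sum: "(\<Sum>i\<in>I. v i) = w * of_real (\<Sum>i\<in>I. l i)" and "i \<in> I" "l i \<ge> 0"
  shows "v i = w * of_real (l i)"
proof -
  define g where "g = (\<lambda>i. (norm w)\<^sup>2 * l i - Re (cnj w * v i))"
  have g: "g i \<ge> 0" if "i \<in> I" for i
  proof -
    have "Re (cnj w * v i) \<le> norm w * norm (v i)"
      using complex_Re_le_cmod[of "cnj w * v i"] by (simp add: norm_mult)
    also have "\<dots> \<le> norm w * (norm w * l i)" using assms that by (intro mult_left_mono) auto
    finally show ?thesis by (simp add: g_def power2_eq_square)
  qed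
  have "(\<Sum>i\<in>I. g i) = (norm w)\<^sup>2 * (\<Sum>i\<in>I. l i) - Re (cnj w * (\<Sum>i\<in>I. v i))"
    by (simp add: g_def sum_subtractf sum_distrib_left)
  also have "cnj w * (\<Sum>i\<in>I. v i) = of_real ((norm w)\<^sup>2 * (\<Sum>i\<in>I. l i))"
    unfolding sum using complex_norm_square[of w] by (simp add: mult_ac)
  finally have "(\<Sum>i\<in>I. g i) = 0" by simp
  then have "g i = 0" using g assms sum_nonneg_eq_0_iff[of I g] by blast
  then have Re: "Re (cnj w * v i) = (norm w)\<^sup>2 * l i" by (simp add: g_def)
  have "(norm (v i - w * of_real (l i)))\<^sup>2
      = (norm (v i))\<^sup>2 - 2 * l i * Re (cnj w * v i) + (norm w)\<^sup>2 * (l i)\<^sup>2"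
    unfolding cmod_power2 by (simp add: power2_eq_square algebra_simps)
  also have "\<dots> = (norm (v i))\<^sup>2 - (norm w * l i)\<^sup>2"
    unfolding Re by (simp add: power2_eq_square)
  also have "\<dots> \<le> 0" using assms by (simp add: power_mono)
  finally show ?thesis by simp
qed

lemma finite_convergent_subsequence:
  fixes f :: "nat \<Rightarrow> 'a \<Rightarrow> complex"
  assumes "finite S" "\<And>x. x \<in> S \<Longrightarrow> bounded (range (\<lambda>n. f n x))"
  shows "\<exists>r l. strict_mono (r :: nat \<Rightarrow> nat) \<and> (\<forall>x\<in>S. (\<lambda>n. f (r n) x) \<longlonglongrightarrow> l x)"
  using assms
proof (induction S rule: finite_induct)
  case empty
  then show ?case by (auto intro: exI[of _ id] simp: strict_mono_id)
next
  case (insert a S)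
  then obtain r l where r: "strict_mono (r :: nat \<Rightarrow> nat)" "\<forall>x\<in>S. (\<lambda>n. f (r n) x) \<longlonglongrightarrow> l x"
    by auto
  have "bounded (range (\<lambda>n. f (r n) a))"
    by (rule bounded_subset[of "range (\<lambda>n. f n a)"]) (use insert in auto)
  then obtain l' r' where r': "strict_mono (r' :: nat \<Rightarrow> nat)" "((\<lambda>n. f (r n) a) \<circ> r') \<longlonglongrightarrow> l'"
    using bounded_imp_convergent_subsequence by blast
  have "(\<lambda>n. f ((r \<circ> r') n) x) \<longlonglongrightarrow> l x" if "x \<in> S" for x
    using LIMSEQ_subseq_LIMSEQ[OF r(2)[rule_format, OF that] r'(1)] by (simp add: o_def)
  then show ?case
    using r r' insert(2)
    by (intro exI[of _ "r \<circ> r'"] exI[of _ "l(a := l')"]) (auto simp: strict_mono_def o_def)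
qed

section \<open>The greedy orbit of 1 and conjugates of modulus at least \<open>q\<close>\<close>

context spectrum_overlap
begin

primrec orbit :: "nat \<Rightarrow> real" where
  "orbit 0 = 1"
| "orbit (Suc i) = q * orbit i - of_int \<lfloor>q * orbit i\<rfloor>"

lemma orbit_bounds: "0 \<le> orbit i \<and> orbit i \<le> 1"
  by (cases i; simp; linarith)

lemma orbit_digit: "0 \<le> \<lfloor>q * orbit i\<rfloor>" "\<lfloor>q * orbit i\<rfloor> \<le> int m"
proof -
  have "0 \<le> q * orbit i" "q * orbit i \<le> q * 1"
    using orbit_bounds[of i] q_gt_1 by (auto intro: mult_left_mono)
  then show "0 \<le> \<lfloor>q * orbit i\<rfloor>" "\<lfloor>q * orbit i\<rfloor> \<le> int m" using q_less by linarith+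
qed

lemma orbit_Y: "orbit i \<in> Y"
proof (induction i)
  case (Suc i)
  then show ?case using Y_step[of "orbit i" "- \<lfloor>q * orbit i\<rfloor>"] orbit_digit[of i] by simp
qed (simp add: Y_1)

end

locale expanding_conjugate = conjugate_pair q m z + spectrum_overlap q m
  for q :: real and m :: nat and z :: complex +
  assumes finY: "\<And>R. finite (Y_set m q \<inter> {-R..R})"
    and z_norm: "norm z \<ge> 1" and z_neq: "z \<noteq> of_real q"
begin

lemma z_nz: "z \<noteq> 0" using z_norm by auto

text \<open>The orbit has finitely many values, so their conjugates are bounded, and if
  \<open>norm z \<ge> q\<close> the greedy expansion of 1 holds in base \<open>z\<close> as well.
  Comparison with base \<open>q\<close> gives \<open>1 / q \<le> Re (1 / z)\<close>, whence
  \<open>z = q\<close>.\<close>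

lemma norm_z_less: "norm z < q"
proof (rule ccontr)
  assume "\<not> norm z < q"
  then have zq: "norm z \<ge> q" by simp
  define d where "d = (\<lambda>i. \<lfloor>q * orbit i\<rfloor>)"
  have d0: "d 0 \<ge> 1" using q_gt_1 by (simp add: d_def le_floor_iff)
  have d: "d i \<ge> 0" for i using orbit_digit by (simp add: d_def)
  have orb: "orbit i / q ^ i = 1 - (\<Sum>j<i. of_int (d j) / q ^ Suc j)" for i
  proof (induction i)
    case (Suc i)
    have "orbit (Suc i) / q ^ Suc i = orbit i / q ^ i - of_int (d i) / q ^ Suc i"
      using q_gt_1 by (simp add: d_def field_simps)
    then show ?case using Suc by simp
  qed simp
  have conj_map_orb: "conj_map (orbit i) / z ^ i = 1 - (\<Sum>j<i. of_int (d j) / z ^ Suc j)" for i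
  proof (induction i)
    case 0
    then show ?case using conj_map_of_int[of 1] by simp
  next
    case (Suc i)
    have "conj_map (orbit (Suc i)) = z * conj_map (orbit i) - of_int (d i)"
      using conj_map_Y_step[OF orbit_Y, of i "- d i"] by (simp add: d_def)
    then have "conj_map (orbit (Suc i)) / z ^ Suc i = conj_map (orbit i) / z ^ i - of_int (d i) / z ^ Suc i"
      using z_nz by (simp add: field_simps)
    then show ?case using Suc by simp
  qed
  define M where "M = Max ((norm \<circ> conj_map) ` (Y \<inter> {-1..1}))"
  have M: "norm (conj_map (orbit i)) \<le> M" for i
    unfolding M_def using finY[of 1] orbit_Y[of i] orbit_bounds[of i]
    by (intro Max_ge) (auto simp: image_iff intro!: bexI[of _ "orbit i"])
  \<comment> \<open>Only the leading digit is kept exactly; later terms are at most their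
    counterparts in base \<open>q\<close>, which sum to at most \<open>1 - d 0 / q\<close>.\<close>
  have key: "of_int (d 0) * (1 / q - Re (1 / z)) \<le> M / q ^ Suc i" for i
  proof -
    have "1 - Re (\<Sum>j<Suc i. of_int (d j) / z ^ Suc j) \<le> norm (conj_map (orbit (Suc i)) / z ^ Suc i)"
      unfolding conj_map_orb using complex_Re_le_cmod[of "1 - (\<Sum>j<Suc i. of_int (d j) / z ^ Suc j)"]
      by simp
    also have "\<dots> \<le> M / q ^ Suc i"
      unfolding norm_divide norm_power using M[of "Suc i"] q_gt_1 zq
      by (intro frac_le power_mono) (auto intro: order_trans[OF norm_ge_zero M] simp del: orbit.simps)
    finally have 1: "1 - Re (\<Sum>j<Suc i. of_int (d j) / z ^ Suc j) \<le> M / q ^ Suc i" .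
    have "Re (\<Sum>j<Suc i. of_int (d j) / z ^ Suc j)
        = of_int (d 0) * Re (1 / z) + (\<Sum>j<i. Re (of_int (d (Suc j)) / z ^ Suc (Suc j)))"
      by (simp add: sum.lessThan_Suc_shift Re_divide del: sum.lessThan_Suc)
    also have "\<dots> \<le> of_int (d 0) * Re (1 / z) + (\<Sum>j<i. of_int (d (Suc j)) / q ^ Suc (Suc j))"
    proof (intro add_left_mono sum_mono)
      fix j
      have "Re (of_int (d (Suc j)) / z ^ Suc (Suc j)) \<le> norm (of_int (d (Suc j)) / z ^ Suc (Suc j))"
        by (rule complex_Re_le_cmod)
      also have "\<dots> = of_int (d (Suc j)) / norm z ^ Suc (Suc j)"
        using d[of "Suc j"] by (simp add: norm_divide norm_power norm_mult del: power_Suc)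
      also have "\<dots> \<le> of_int (d (Suc j)) / q ^ Suc (Suc j)"
        using d zq q_gt_1 z_nz by (intro divide_left_mono power_mono mult_pos_pos) auto
      finally show "Re (of_int (d (Suc j)) / z ^ Suc (Suc j)) \<le> of_int (d (Suc j)) / q ^ Suc (Suc j)" .
    qed
    also have "\<dots> = of_int (d 0) * Re (1 / z) + (1 - orbit (Suc i) / q ^ Suc i - of_int (d 0) / q)"
      unfolding orb by (simp add: sum.lessThan_Suc_shift del: sum.lessThan_Suc)
    also have "\<dots> \<le> of_int (d 0) * Re (1 / z) + (1 - of_int (d 0) / q)"
      using orbit_bounds[of "Suc i"] q_gt_1 by (simp del: orbit.simps)
    finally show ?thesis using 1 by (simp add: algebra_simps)
  qed
  have "(\<lambda>i. M / q ^ Suc i) \<longlonglongrightarrow> 0"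
    using LIMSEQ_Suc[OF tendsto_mult_right_zero[OF LIMSEQ_inverse_realpow_zero[OF q_gt_1], of M]]
    by (simp add: field_simps)
  then have "of_int (d 0) * (1 / q - Re (1 / z)) \<le> 0"
    by (rule tendsto_lowerbound) (use key in auto)
  then have "1 / q \<le> Re (1 / z)" using d0 by (simp add: mult_le_0_iff)
  moreover have "norm (1 / z) \<le> 1 / q" using zq q_gt_1 by (simp add: norm_divide frac_le)
  ultimately have "1 / z = of_real (1 / q)" by (intro Re_eq_norm_imp_eq)
  then have "z = of_real q" by simp
  then show False using z_neq by simp
qed

end

section \<open>Cutting intervals into cells\<close>

definition clip :: "real \<Rightarrow> real \<Rightarrow> real \<Rightarrow> real" where
  "clip a b x = max a (min b x)"

lemma clip_bounds: "a \<le> b \<Longrightarrow> a \<le> clip a b x \<and> clip a b x \<le> b"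
  by (auto simp: clip_def)

lemma clip_mono: "x \<le> y \<Longrightarrow> clip a b x \<le> clip a b y"
  by (auto simp: clip_def)

text \<open>A cell \<open>[x, y]\<close> meeting \<open>[a, b]\<close> in more than a point is
  clipped to a part of itself; any other cell degenerates and drops out of telescoping sums.\<close>

lemma clip_less: "a \<le> b \<Longrightarrow> clip a b x < clip a b y \<Longrightarrow> x \<le> clip a b x \<and> clip a b y \<le> y"
  by (auto simp: clip_def max_def min_def split: if_splits)

lemma clip_cases: "clip a b x = a \<or> clip a b x = b \<or> clip a b x = x"
  by (auto simp: clip_def max_def min_def)

lemma clip_telescope:
  fixes H :: "real \<Rightarrow> 'a :: ab_group_add" and x :: "nat \<Rightarrow> real"
  assumes "a \<le> b" "x 0 \<le> a" "b \<le> x (Suc n)"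
  shows "(\<Sum>c\<le>n. H (clip a b (x (Suc c))) - H (clip a b (x c))) = H b - H a"
proof -
  have "(\<Sum>c\<le>n. H (clip a b (x (Suc c))) - H (clip a b (x c)))
      = H (clip a b (x (Suc n))) - H (clip a b (x 0))"
    using sum_lessThan_telescope[of "\<lambda>c. H (clip a b (x c))" "Suc n"]
    by (simp add: lessThan_Suc_atMost)
  moreover have "clip a b (x (Suc n)) = b" "clip a b (x 0) = a"
    using assms by (auto simp: clip_def)
  ultimately show ?thesis by simp
qed

section \<open>Integrals of digit functionals and of conjugate errors\<close>

context spectrum
begin

text \<open>An integral over \<open>[0, t]\<close>, where \<open>w\<close> is the weight of the
  first digit, \<open>f\<close> the primitive for the later digits and \<open>e = f 1\<close>: the
  full cells of digits below \<open>c\<close>, then a part of cell \<open>c\<close>. Stretching the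
  cells yields the factor \<open>1 / q\<close>.\<close>

definition psi_step :: "complex \<Rightarrow> complex \<Rightarrow> (real \<Rightarrow> complex) \<Rightarrow> real \<Rightarrow> nat \<Rightarrow> complex" where
  "psi_step w e f t c =
    ((\<Sum>d<c. w * of_nat d + e) + w * of_nat c * of_real (q * t - real c) + f (q * t - real c)) / of_real q"

end

context expanding_conjugate
begin

text \<open>\<open>psi i t\<close> is the integral over \<open>[0, t]\<close> of \<open>\<Sum>k<i. z ^ (i - 1 - k) * d\<^sub>k\<close>, where
  \<open>d\<^sub>0, d\<^sub>1, \<dots>\<close> are the greedy base \<open>q\<close> digits of the variable of integration.\<close>
primrec psi :: "nat \<Rightarrow> real \<Rightarrow> complex" where
  "psi 0 = (\<lambda>t. 0)"
| "psi (Suc i) = (\<lambda>t. psi_step (z ^ i) (psi i 1) (psi i) t (nat \<lfloor>q * t\<rfloor>))"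

lemma psi_0 [simp]: "psi i 0 = 0"
  by (induction i) (auto simp: psi_step_def)

text \<open>At the right end \<open>q * t = c + 1\<close> the floor has already jumped, but the
  formula for \<open>c\<close> then counts a complete cell and agrees. So cells may be taken
  closed.\<close>

lemma psi_Suc:
  assumes "real c \<le> q * t" "q * t \<le> real c + 1"
  shows "psi (Suc i) t = psi_step (z ^ i) (psi i 1) (psi i) t c"
proof (cases "q * t = real c + 1")
  case True
  have *: "nat \<lfloor>q * t\<rfloor> = Suc c" "q * t - real (Suc c) = 0" "q * t - real c = 1"
    using True by auto
  show ?thesis unfolding psi.simps psi_step_def * by simp
next
  case False
  then have "nat \<lfloor>q * t\<rfloor> = c" using assms by linarith
  then show ?thesis by simp
qed

lemma psi_Suc_diff:
  assumes "real c \<le> q * a" "a \<le> b" "q * b \<le> real c + 1"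
  shows "psi (Suc i) b - psi (Suc i) a =
    z ^ i * of_nat c * of_real (b - a) + (psi i (q * b - real c) - psi i (q * a - real c)) / of_real q"
proof -
  have "q * a \<le> q * b" using assms q_gt_1 by simp
  then have "psi (Suc i) b = psi_step (z ^ i) (psi i 1) (psi i) b c"
    "psi (Suc i) a = psi_step (z ^ i) (psi i 1) (psi i) a c"
    using assms by (auto intro!: psi_Suc simp del: psi.simps)
  then show ?thesis
    using q_gt_1 by (simp add: psi_step_def add_divide_distrib diff_divide_distrib right_diff_distrib
        left_diff_distrib del: psi.simps)
qed

definition lip :: "nat \<Rightarrow> real" where
  "lip i = real m * (\<Sum>l<i. norm z ^ l)"

text \<open>By \<open>q < m + 1\<close> the \<open>m + 1\<close> cells of length
  \<open>1 / q\<close> cover \<open>[0, 1]\<close>.\<close>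

lemma q_inverse_steps: "b \<le> 1 \<Longrightarrow> b \<le> real (Suc m) / q"
proof -
  assume "b \<le> 1"
  then have "b * q \<le> 1 * q" using q_gt_1 by (intro mult_right_mono) auto
  then have "b * q \<le> real (Suc m)" unfolding of_nat_Suc using q_less by linarith
  then show "b \<le> real (Suc m) / q" using q_gt_1 by (simp add: pos_le_divide_eq)
qed

text \<open>\<open>lip i\<close> bounds the integrand of \<open>psi i\<close>. The interval is cut
  at the points \<open>c / q\<close>; on a cell the stretching by \<open>q\<close> cancels
  \<open>1 / q\<close>, and the leading digit adds at most \<open>m * norm z ^ i\<close>.\<close>

lemma psi_lipschitz:
  assumes "0 \<le> a" "a \<le> b" "b \<le> 1"
  shows "norm (psi i b - psi i a) \<le> lip i * (b - a)"
  using assms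
proof (induction i arbitrary: a b)
  case 0
  then show ?case by (simp add: lip_def)
next
  case (Suc i)
  let ?x = "\<lambda>c. real c / q"
  let ?p = "\<lambda>c. clip a b (?x c)"
  have piece: "norm (psi (Suc i) (?p (Suc c)) - psi (Suc i) (?p c)) \<le> lip (Suc i) * (?p (Suc c) - ?p c)"
    if "c \<le> m" for c
  proof (cases "?p c < ?p (Suc c)")
    case True
    define \<alpha> where "\<alpha> = ?p c"
    define \<beta> where "\<beta> = ?p (Suc c)"
    have "?x c \<le> \<alpha>" "\<beta> \<le> ?x (Suc c)"
      using clip_less[OF Suc.prems(2) True] by (auto simp: \<alpha>_def \<beta>_def)
    then have c: "real c \<le> q * \<alpha>" "q * \<beta> \<le> real c + 1"
      using q_gt_1 by (auto simp: field_simps)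
    have ab: "\<alpha> \<le> \<beta>" using True by (simp add: \<alpha>_def \<beta>_def)
    have "norm (psi (Suc i) \<beta> - psi (Suc i) \<alpha>)
        \<le> norm (z ^ i * of_nat c * of_real (\<beta> - \<alpha>))
          + norm ((psi i (q * \<beta> - real c) - psi i (q * \<alpha> - real c)) / of_real q)"
      unfolding psi_Suc_diff[OF c(1) ab c(2)] by (rule norm_triangle_ineq)
    also have "norm (z ^ i * of_nat c * of_real (\<beta> - \<alpha>)) = norm z ^ i * real c * (\<beta> - \<alpha>)"
      using ab by (simp add: norm_mult norm_power del: of_real_diff)
    also have "\<dots> \<le> norm z ^ i * real m * (\<beta> - \<alpha>)"
      using that ab by (intro mult_right_mono mult_left_mono) auto
    also have "norm ((psi i (q * \<beta> - real c) - psi i (q * \<alpha> - real c)) / of_real q)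
        \<le> lip i * ((q * \<beta> - real c) - (q * \<alpha> - real c)) / q"
      unfolding norm_divide using c ab q_gt_1 Suc.IH[of "q * \<alpha> - real c" "q * \<beta> - real c"]
      by (auto intro!: divide_right_mono)
    also have "\<dots> = lip i * (\<beta> - \<alpha>)" using q_gt_1 by (simp add: field_simps)
    finally show ?thesis by (simp add: lip_def \<alpha>_def \<beta>_def algebra_simps del: psi.simps)
  next
    case False
    then have "?p (Suc c) = ?p c"
      using clip_mono[of "?x c" "?x (Suc c)" a b] q_gt_1 by (simp add: divide_right_mono)
    then show ?thesis by simp
  qed
  have tel: "(\<Sum>c\<le>m. H (?p (Suc c)) - H (?p c)) = H b - H a" for H :: "real \<Rightarrow> 'b :: ab_group_add"
    by (rule clip_telescope) (use Suc.prems q_inverse_steps in auto)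
  have "norm (psi (Suc i) b - psi (Suc i) a) = norm (\<Sum>c\<le>m. psi (Suc i) (?p (Suc c)) - psi (Suc i) (?p c))"
    by (simp only: tel)
  also have "\<dots> \<le> (\<Sum>c\<le>m. lip (Suc i) * (?p (Suc c) - ?p c))"
    by (rule order_trans[OF norm_sum]) (intro sum_mono piece, simp)
  also have "\<dots> = lip (Suc i) * (b - a)"
    using tel[of "\<lambda>x. x"] by (simp add: sum_distrib_left[symmetric])
  finally show ?case .
qed

text \<open>A state \<open>(e, w, a, b)\<close> stands for the pairs \<open>(x, x - e)\<close> of points of \<open>[0, 1]\<close> with
  \<open>a \<le> x \<le> b\<close>, where \<open>w\<close> is the conjugate of \<open>e\<close>; its children collect the images of these pairs
  under the greedy map, according to the pair \<open>(c, c')\<close> of digits.  \<open>area i\<close> is the integral over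
  the state of the conjugate error after \<open>i\<close> steps.\<close>
fun area :: "nat \<Rightarrow> real \<times> complex \<times> real \<times> real \<Rightarrow> complex" where
  "area i (e, w, a, b) =
    z ^ i * w * of_real (b - a) - (psi i b - psi i a) + (psi i (b - e) - psi i (a - e))"

fun len :: "real \<times> complex \<times> real \<times> real \<Rightarrow> real" where
  "len (e, w, a, b) = b - a"

text \<open>The \<open>x\<close> in \<open>[a, b]\<close> with first digit \<open>c\<close> for
  which \<open>x - e\<close> has first digit \<open>c'\<close> fill the interval from
  \<open>cut e a b c c'\<close> to \<open>cut e a b c (Suc c')\<close>; if they form no proper
  interval, the two cuts coincide.\<close>

definition cut :: "real \<Rightarrow> real \<Rightarrow> real \<Rightarrow> nat \<Rightarrow> nat \<Rightarrow> real" where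
  "cut e a b c c' = clip (clip a b (real c / q)) (clip a b (real (Suc c) / q)) (e + real c' / q)"

fun child :: "real \<times> complex \<times> real \<times> real \<Rightarrow> nat \<times> nat \<Rightarrow> real \<times> complex \<times> real \<times> real" where
  "child (e, w, a, b) (c, c') =
    (q * e + real c' - real c, z * w + of_nat c' - of_nat c,
     q * cut e a b c c' - real c, q * cut e a b c (Suc c') - real c)"

text \<open>The condition on the endpoints is inherited by children, hence the states form a finite
  Markov system.\<close>
definition valid :: "real \<Rightarrow> real \<Rightarrow> real \<Rightarrow> bool" where
  "valid e a b \<longleftrightarrow> 0 \<le> a \<and> a < b \<and> b \<le> 1 \<and> 0 \<le> a - e \<and> b - e \<le> 1 \<and>
    (a \<in> Y \<or> a - e \<in> Y) \<and> (b \<in> Y \<or> b - e \<in> Y)"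

lemma cut_mono: "c' \<le> d' \<Longrightarrow> cut e a b c c' \<le> cut e a b c d'"
  unfolding cut_def using q_gt_1 by (intro clip_mono) (simp add: divide_right_mono)

lemma cut_telescope:
  fixes H :: "real \<Rightarrow> 'b :: ab_group_add"
  assumes "valid e a b"
  shows "(\<Sum>c\<le>m. \<Sum>c'\<le>m. H (cut e a b c (Suc c')) - H (cut e a b c c')) = H b - H a"
proof -
  have v: "0 \<le> a" "a < b" "b \<le> 1" "0 \<le> a - e" "b - e \<le> 1" using assms by (auto simp: valid_def)
  have "(\<Sum>c'\<le>m. H (cut e a b c (Suc c')) - H (cut e a b c c'))
      = H (clip a b (real (Suc c) / q)) - H (clip a b (real c / q))" for c
    unfolding cut_def
  proof (rule clip_telescope[where x = "\<lambda>c'. e + real c' / q"])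
    show "clip a b (real c / q) \<le> clip a b (real (Suc c) / q)"
      using q_gt_1 by (intro clip_mono) (simp add: divide_right_mono)
    show "e + real 0 / q \<le> clip a b (real c / q)"
      using clip_bounds[of a b "real c / q"] v by simp
    show "clip a b (real (Suc c) / q) \<le> e + real (Suc m) / q"
      using clip_bounds[of a b "real (Suc c) / q"] v q_inverse_steps[of "b - e"] by linarith
  qed
  moreover have "(\<Sum>c\<le>m. H (clip a b (real (Suc c) / q)) - H (clip a b (real c / q))) = H b - H a"
    by (rule clip_telescope) (use v q_inverse_steps in auto)
  ultimately show ?thesis by simp
qed

lemma cut_props:
  assumes v: "valid e a b" and less: "cut e a b c c' < cut e a b c (Suc c')"
  shows "real c \<le> q * cut e a b c c'" "q * cut e a b c (Suc c') \<le> real c + 1"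
    "real c' \<le> q * (cut e a b c c' - e)" "q * (cut e a b c (Suc c') - e) \<le> real c' + 1"
proof -
  define p where "p = clip a b (real c / q)"
  define p' where "p' = clip a b (real (Suc c) / q)"
  have pp': "p \<le> p'" unfolding p_def p'_def using q_gt_1 by (intro clip_mono) (simp add: divide_right_mono)
  have cut: "cut e a b c d = clip p p' (e + real d / q)" for d
    by (simp add: cut_def p_def p'_def)
  note cb = clip_bounds[OF pp']
  have "p < p'" using less cb[of "e + real c' / q"] cb[of "e + real (Suc c') / q"] unfolding cut by linarith
  then have "real c / q \<le> p" "p' \<le> real (Suc c) / q"
    using clip_less[of a b "real c / q" "real (Suc c) / q"] v unfolding p_def p'_def valid_def by auto
  moreover have "p \<le> cut e a b c c'" "cut e a b c (Suc c') \<le> p'" unfolding cut using cb by auto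
  ultimately have 1: "real c / q \<le> cut e a b c c'" "cut e a b c (Suc c') \<le> real (Suc c) / q" by linarith+
  then show "real c \<le> q * cut e a b c c'" "q * cut e a b c (Suc c') \<le> real c + 1"
    using q_gt_1 by (simp_all add: field_simps)
  have "e + real c' / q \<le> cut e a b c c'" "cut e a b c (Suc c') \<le> e + real (Suc c') / q"
    using clip_less[OF pp'] less unfolding cut by blast+
  then show "real c' \<le> q * (cut e a b c c' - e)" "q * (cut e a b c (Suc c') - e) \<le> real c' + 1"
    using q_gt_1 by (simp_all add: field_simps)
qed

text \<open>A cut is an old endpoint or a cell boundary for \<open>x\<close> or for
  \<open>x - e\<close>; the greedy map sends the coordinate on a boundary to 0 or 1, both in
  \<open>Y\<close>.\<close>

lemma child_valid:
  assumes v: "valid e a b" and less: "cut e a b c c' < cut e a b c (Suc c')" and c: "c \<le> m" "c' \<le> m"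
  shows "valid (q * e + real c' - real c) (q * cut e a b c c' - real c) (q * cut e a b c (Suc c') - real c)"
proof -
  define e' where "e' = q * e + real c' - real c"
  have endpoint: "q * x - real c \<in> Y \<or> q * x - real c - e' \<in> Y"
    if x: "x \<in> {a, b, real c / q, real (Suc c) / q, e + real c' / q, e + real (Suc c') / q}" for x
  proof -
    have shift: "q * x - real c - e' = q * (x - e) - real c'" by (simp add: e'_def algebra_simps)
    have YD: "q * y - real d \<in> Y" if "y \<in> Y" "d \<le> m" for y d
      using Y_step[OF that(1), of "- int d"] that(2) by simp
    consider "x = a" | "x = b" | "x = real c / q \<or> x = real (Suc c) / q"
      | "x = e + real c' / q \<or> x = e + real (Suc c') / q" using x by blast
    then show ?thesis
    proof cases
      case 1
      then show ?thesis using v YD[of a c] YD[of "a - e" c'] c unfolding shift valid_def by auto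
    next
      case 2
      then show ?thesis using v YD[of b c] YD[of "b - e" c'] c unfolding shift valid_def by auto
    next
      case 3
      then have "q * x - real c = 0 \<or> q * x - real c = 1" using q_gt_1 by auto
      then show ?thesis using Y_0 Y_1 by auto
    next
      case 4
      then have "q * (x - e) - real c' = 0 \<or> q * (x - e) - real c' = 1" using q_gt_1 by auto
      then show ?thesis unfolding shift using Y_0 Y_1 by auto
    qed
  qed
  have "cut e a b c d \<in> {a, b, real c / q, real (Suc c) / q, e + real d / q}" for d
    unfolding cut_def using clip_cases by (smt (verit) insertCI)
  then have "cut e a b c c' \<in> {a, b, real c / q, real (Suc c) / q, e + real c' / q, e + real (Suc c') / q}"
    "cut e a b c (Suc c') \<in> {a, b, real c / q, real (Suc c) / q, e + real c' / q, e + real (Suc c') / q}"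
    by blast+
  note ends = endpoint[OF this(1)] endpoint[OF this(2)]
  show ?thesis
    using ends cut_props[OF v less] less q_gt_1 unfolding valid_def e'_def
    by (simp add: algebra_simps)
qed

text \<open>Substitution of \<open>q * x - c\<close>: the Jacobian is \<open>1 / q\<close>, and the
  first digits move into the conjugate error \<open>z * w + c' - c\<close>. A degenerate piece gives
  0 on both sides.\<close>

lemma area_child:
  assumes v: "valid e a b" 
  shows "(z ^ Suc i * w * of_real (cut e a b c (Suc c') - cut e a b c c')
      - (psi (Suc i) (cut e a b c (Suc c')) - psi (Suc i) (cut e a b c c'))
      + (psi (Suc i) (cut e a b c (Suc c') - e) - psi (Suc i) (cut e a b c c' - e)))
    = area i (child (e, w, a, b) (c, c')) / of_real q"
proof (cases "cut e a b c c' < cut e a b c (Suc c')")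
  case True
  define \<alpha> where "\<alpha> = cut e a b c c'"
  define \<beta> where "\<beta> = cut e a b c (Suc c')"
  note cp = cut_props[OF v True, folded \<alpha>_def \<beta>_def]
  have ab: "\<alpha> \<le> \<beta>" "\<alpha> - e \<le> \<beta> - e" using True by (simp_all add: \<alpha>_def \<beta>_def)
  have q0: "complex_of_real q \<noteq> 0" using q_gt_1 by simp
  have 1: "q * \<beta> - real c - (q * e + real c' - real c) = q * (\<beta> - e) - real c'"
    "q * \<alpha> - real c - (q * e + real c' - real c) = q * (\<alpha> - e) - real c'"
    by (simp_all add: algebra_simps)
  have 2: "area i (child (e, w, a, b) (c, c')) =
      z ^ i * (z * w + of_nat c' - of_nat c) * (of_real q * of_real (\<beta> - \<alpha>))
      - (psi i (q * \<beta> - real c) - psi i (q * \<alpha> - real c))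
      + (psi i (q * (\<beta> - e) - real c') - psi i (q * (\<alpha> - e) - real c'))"
    unfolding child.simps area.simps \<alpha>_def[symmetric] \<beta>_def[symmetric] 1 by (simp add: algebra_simps)
  have 3: "(\<beta> - e) - (\<alpha> - e) = \<beta> - \<alpha>" by simp
  show ?thesis
    unfolding \<alpha>_def[symmetric] \<beta>_def[symmetric] psi_Suc_diff[OF cp(1) ab(1) cp(2)]
      psi_Suc_diff[OF cp(3) ab(2) cp(4)] 2 3
    using q0 by (simp add: add_divide_distrib diff_divide_distrib ring_distribs del: of_real_diff)
next
  case False
  then have "cut e a b c (Suc c') = cut e a b c c'" using cut_mono[of c' "Suc c'" e a b c] by simp
  then show ?thesis by simp
qed

lemma area_Suc:
  assumes v: "valid e a b"
  shows "area (Suc i) (e, w, a, b) = (\<Sum>cc\<in>{..m} \<times> {..m}. area i (child (e, w, a, b) cc)) / of_real q"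
proof -
  define H where "H = (\<lambda>x. z ^ Suc i * w * of_real x - psi (Suc i) x + psi (Suc i) (x - e))"
  have "area (Suc i) (e, w, a, b) = H b - H a"
    by (simp add: H_def algebra_simps del: psi.simps)
  also have "\<dots> = (\<Sum>c\<le>m. \<Sum>c'\<le>m. H (cut e a b c (Suc c')) - H (cut e a b c c'))"
    using cut_telescope[OF v, of H] by simp
  also have "\<dots> = (\<Sum>c\<le>m. \<Sum>c'\<le>m. area i (child (e, w, a, b) (c, c')) / of_real q)"
    unfolding area_child[OF v, symmetric]
    by (intro sum.cong refl) (simp add: H_def algebra_simps del: psi.simps)
  also have "\<dots> = (\<Sum>cc\<in>{..m} \<times> {..m}. area i (child (e, w, a, b) cc) / of_real q)"
    by (auto simp: sum.cartesian_product intro!: sum.cong simp del: area.simps child.simps)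
  finally show ?thesis by (simp only: sum_divide_distrib)
qed

lemma len_children:
  assumes v: "valid e a b"
  shows "(\<Sum>cc\<in>{..m} \<times> {..m}. len (child (e, w, a, b) cc)) = q * (b - a)"
proof -
  have "(\<Sum>cc\<in>{..m} \<times> {..m}. len (child (e, w, a, b) cc))
      = (\<Sum>c\<le>m. \<Sum>c'\<le>m. q * cut e a b c (Suc c') - q * cut e a b c c')"
    by (auto simp: sum.cartesian_product intro!: sum.cong)
  also have "\<dots> = q * b - q * a"
    by (rule cut_telescope[OF v, of "\<lambda>x. q * x"])
  finally show ?thesis by (simp add: algebra_simps)
qed

lemma area_eq_0: "len \<tau> = 0 \<Longrightarrow> area i \<tau> = 0"
  by (cases \<tau>) simp

end

section \<open>The finite Markov system of states\<close>

locale shifted_conjugate = expanding_conjugate +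
  fixes h :: real
  assumes h_pos: "h > 0" and h_Zq: "h \<in> Zq"
    and finE: "finite (\<Union>i. {y - q ^ i * h | y. y \<in> Y_set m q \<and> \<bar>y - q ^ i * h\<bar> \<le> 1})"
begin

definition E :: "real set" where
  "E = (\<Union>i. {y - q ^ i * h | y. y \<in> Y \<and> \<bar>y - q ^ i * h\<bar> \<le> 1})"

text \<open>Differences \<open>y - q ^ (i - j) * h\<close> with an exponent of either sign. The
  conjugate \<open>w\<close> is carried along explicitly, because \<open>h / q ^ j\<close> need not
  lie in \<open>Zq\<close>.\<close>

definition level :: "nat \<Rightarrow> real \<Rightarrow> complex \<Rightarrow> bool" where
  "level j e w \<longleftrightarrow> (\<exists>y\<in>Y. \<exists>i. (i = 0 \<or> j = 0) \<and> e = y - q ^ i * h / q ^ j \<and> w = conj_map y - z ^ i * conj_map h / z ^ j)"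

definition states :: "(real \<times> complex \<times> real \<times> real) set" where
  "states = {(e, w, a, b). level 0 e w \<and> valid e a b}"

text \<open>Multiplication by \<open>q\<close> raises the exponent of \<open>q\<close> before
  \<open>h\<close>: for \<open>j > 0\<close> the level drops, at level 0 it stays and
  \<open>i\<close> grows; truncated subtraction covers both.\<close>

lemma level_child:
  assumes "level j e w" "c \<le> m" "c' \<le> m"
  shows "level (j - 1) (q * e + real c' - real c) (z * w + of_nat c' - of_nat c)"
proof -
  obtain y i where y: "y \<in> Y" "i = 0 \<or> j = 0" "e = y - q ^ i * h / q ^ j" "w = conj_map y - z ^ i * conj_map h / z ^ j"
    using assms(1) by (auto simp: level_def)
  let ?y = "q * y + of_int (int c' - int c)"
  have Y: "?y \<in> Y" using y(1) assms by (intro Y_step) auto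
  have sgy: "conj_map ?y = z * conj_map y + of_int (int c' - int c)" using y(1) by (rule conj_map_Y_step)
  show ?thesis
  proof (cases j)
    case 0
    then show ?thesis unfolding level_def
      by (intro bexI[OF _ Y] exI[of _ "Suc i"]) (simp add: sgy y algebra_simps del: of_int_diff, simp add: algebra_simps)
  next
    case (Suc k)
    have "q * e + real c' - real c = ?y - h / q ^ k"
      using q_gt_1 y Suc by (simp add: field_simps)
    moreover have "z * w + of_nat c' - of_nat c = conj_map ?y - conj_map h / z ^ k"
      unfolding sgy using z_nz y Suc by (simp add: field_simps)
    ultimately show ?thesis unfolding level_def Suc
      by (intro bexI[OF _ Y] exI[of _ 0]) simp
  qed
qed

lemma level_0_E: "level 0 e w \<Longrightarrow> \<bar>e\<bar> \<le> 1 \<Longrightarrow> e \<in> E"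
  by (auto simp: level_def E_def)

lemma level_0_conj_map: "level 0 e w \<Longrightarrow> w = conj_map e"
  using conj_map_diff conj_map_mult_power[OF h_Zq] Y_subset_Zq by (fastforce simp: level_def)

lemma valid_abs: "valid e a b \<Longrightarrow> \<bar>e\<bar> \<le> 1"
  by (auto simp: valid_def)

text \<open>The difference \<open>e\<close> lies in the finite set \<open>E\<close> and determines
  \<open>w\<close>; an endpoint is a bounded element of \<open>Y\<close>, possibly shifted by
  \<open>e\<close>.\<close>

lemma finite_states: "finite states"
proof -
  define C where "C = Y \<inter> {-1..1}"
  define D where "D = C \<union> (\<Union>e\<in>E. (\<lambda>y. y + e) ` C)"
  have "finite E" using finE by (simp add: E_def)
  moreover have "finite C" using finY[of 1] by (simp add: C_def)
  ultimately have "finite (E \<times> conj_map ` E \<times> D \<times> D)" by (simp add: D_def)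
  moreover have "states \<subseteq> E \<times> conj_map ` E \<times> D \<times> D"
  proof
    fix \<tau> assume "\<tau> \<in> states"
    then obtain e w a b where \<tau>: "\<tau> = (e, w, a, b)" "(e, w, a, b) \<in> states" by (cases \<tau>) auto
    then have l: "level 0 e w" and v: "valid e a b" by (auto simp: states_def)
    have e: "e \<in> E" using level_0_E[OF l valid_abs[OF v]] .
    have "x \<in> D" if "x \<in> Y \<or> x - e \<in> Y" "0 \<le> x" "x \<le> 1" "0 \<le> x - e" "x - e \<le> 1" for x
    proof (cases "x \<in> Y")
      case True
      then show ?thesis using that by (simp add: D_def C_def)
    next
      case False
      then have "x - e \<in> C" using that by (simp add: C_def)
      then have "x \<in> (\<lambda>y. y + e) ` C" by (intro image_eqI[of _ _ "x - e"]) auto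
      then show ?thesis using e by (auto simp: D_def)
    qed
    then show "\<tau> \<in> E \<times> conj_map ` E \<times> D \<times> D"
      using e v level_0_conj_map[OF l] by (auto simp: \<tau>(1) valid_def)
  qed
  ultimately show ?thesis by (rule finite_subset[rotated])
qed

lemma child_states:
  assumes "(e, w, a, b) \<in> states" "cc \<in> {..m} \<times> {..m}" "len (child (e, w, a, b) cc) \<noteq> 0"
  shows "child (e, w, a, b) cc \<in> states"
proof -
  obtain c c' where cc: "cc = (c, c')" "c \<le> m" "c' \<le> m" using assms(2) by auto
  have "cut e a b c c' < cut e a b c (Suc c')"
    using assms(3) cut_mono[of c' "Suc c'" e a b c] by (auto simp: cc)
  then show ?thesis
    using assms(1) child_valid[of e a b c c'] level_child[of 0 e w c c'] cc by (auto simp: states_def)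
qed

lemma states_valid: "(e, w, a, b) \<in> states \<Longrightarrow> valid e a b"
  by (simp add: states_def)

lemma len_states: "\<tau> \<in> states \<Longrightarrow> len \<tau> > 0"
  by (cases \<tau>) (auto simp: states_def valid_def)

text \<open>At \<open>i = 0\<close> the area is \<open>w * len\<close> with finitely many
  \<open>w\<close>. Each step sums over children and divides by \<open>q\<close>, while the lengths
  of the children add up to \<open>q * len\<close>; so one \<open>M\<close> serves all
  \<open>i\<close>.\<close>

lemma area_bound_obtains:
  obtains M where "M > 0" "\<And>i \<tau>. \<tau> \<in> states \<Longrightarrow> norm (area i \<tau>) \<le> M * len \<tau>"
proof -
  define M where "M = Max (insert 1 ((norm \<circ> conj_map) ` E))"
  have finE': "finite E" using finE by (simp add: E_def)
  have M1: "M \<ge> 1" unfolding M_def using finE' by (intro Max_ge) auto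
  have Me: "norm (conj_map e) \<le> M" if "e \<in> E" for e
    unfolding M_def using finE' that by (intro Max_ge) auto
  have "norm (area i \<tau>) \<le> M * len \<tau>" if "\<tau> \<in> states" for i \<tau>
    using that
  proof (induction i arbitrary: \<tau>)
    case 0
    obtain e w a b where \<tau>: "\<tau> = (e, w, a, b)" by (cases \<tau>)
    then have l: "level 0 e w" "valid e a b" using 0 by (auto simp: states_def)
    then have "norm w \<le> M" using level_0_conj_map level_0_E valid_abs Me by metis
    then show ?case using l by (auto simp: \<tau> norm_mult valid_def intro!: mult_right_mono simp del: of_real_diff)
  next
    case (Suc i)
    obtain e w a b where \<tau>: "\<tau> = (e, w, a, b)" by (cases \<tau>)
    have v: "valid e a b" using Suc.prems by (simp add: \<tau> states_def)
    have "norm (area (Suc i) \<tau>) = norm (\<Sum>cc\<in>{..m} \<times> {..m}. area i (child \<tau> cc)) / q"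
      unfolding \<tau> area_Suc[OF v] using q_gt_1 by (simp add: norm_divide del: child.simps area.simps)
    also have "\<dots> \<le> (\<Sum>cc\<in>{..m} \<times> {..m}. M * len (child \<tau> cc)) / q"
    proof (intro divide_right_mono order_trans[OF norm_sum] sum_mono)
      fix cc assume cc: "cc \<in> {..m} \<times> {..m}"
      show "norm (area i (child \<tau> cc)) \<le> M * len (child \<tau> cc)"
      proof (cases "len (child \<tau> cc) = 0")
        case True
        then show ?thesis by (simp add: area_eq_0)
      next
        case False
        then show ?thesis using Suc child_states[of e w a b cc] cc by (simp add: \<tau> del: child.simps area.simps)
      qed
    qed (use q_gt_1 in auto)
    also have "\<dots> = M * len \<tau>"
      using len_children[OF v, of w] q_gt_1 by (simp add: \<tau> sum_distrib_left[symmetric] del: child.simps)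
    finally show ?case .
  qed
  then show ?thesis using that[of M] M1 by auto
qed

section \<open>Cesaro means on the Markov system\<close>

definition cesaro :: "nat \<Rightarrow> real \<times> complex \<times> real \<times> real \<Rightarrow> complex" where
  "cesaro n \<tau> = (\<Sum>i<n. area i \<tau> / z ^ i) / of_nat n"

lemma cesaro_bound:
  assumes "\<And>i. norm (area i \<tau>) \<le> K"
  shows "norm (cesaro n \<tau>) \<le> K"
proof (cases "n = 0")
  case True
  then show ?thesis using order_trans[OF norm_ge_zero assms] by (simp add: cesaro_def)
next
  case False
  have "norm (\<Sum>i<n. area i \<tau> / z ^ i) \<le> (\<Sum>i<n. K)"
  proof (intro order_trans[OF norm_sum] sum_mono)
    fix i
    have "norm (area i \<tau> / z ^ i) \<le> norm (area i \<tau>) / 1"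
      unfolding norm_divide norm_power using z_norm z_nz by (intro divide_left_mono) (auto simp: one_le_power)
    then show "norm (area i \<tau> / z ^ i) \<le> K" using assms[of i] by simp
  qed
  then show ?thesis using False by (simp add: cesaro_def norm_divide field_simps)
qed

text \<open>Passing to the children shifts the index by one, which produces the factor
  \<open>z\<close>; the first and last summands are the only discrepancy and are divided by
  \<open>n\<close>.\<close>

lemma cesaro_children:
  assumes v: "valid e a b" and n: "n > 0"
  shows "(\<Sum>cc\<in>{..m} \<times> {..m}. cesaro n (child (e, w, a, b) cc)) =
    of_real q * z * (cesaro n (e, w, a, b) + (area n (e, w, a, b) / z ^ n - area 0 (e, w, a, b)) / of_nat n)"
proof -
  let ?\<tau> = "(e, w, a, b)"
  have q0: "complex_of_real q \<noteq> 0" using q_gt_1 by simp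
  have "(\<Sum>cc\<in>{..m} \<times> {..m}. cesaro n (child ?\<tau> cc))
      = (\<Sum>i<n. (\<Sum>cc\<in>{..m} \<times> {..m}. area i (child ?\<tau> cc)) / z ^ i) / of_nat n"
    unfolding cesaro_def sum_divide_distrib[symmetric] by (subst sum.swap) (simp add: sum_divide_distrib)
  also have "\<dots> = (\<Sum>i<n. of_real q * z * (area (Suc i) ?\<tau> / z ^ Suc i)) / of_nat n"
    unfolding area_Suc[OF v] using q0 z_nz by (intro arg_cong2[of _ _ _ _ "(/)"] sum.cong refl) simp
  also have "\<dots> = of_real q * z * ((\<Sum>i<n. area (Suc i) ?\<tau> / z ^ Suc i) / of_nat n)"
    by (simp only: sum_distrib_left times_divide_eq_right)
  also have "(\<Sum>i<n. area (Suc i) ?\<tau> / z ^ Suc i)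
      = (\<Sum>i<n. area i ?\<tau> / z ^ i) + (area n ?\<tau> / z ^ n - area 0 ?\<tau>)"
    using sum.lessThan_Suc_shift[of "\<lambda>i. area i ?\<tau> / z ^ i" n]
    by (simp del: area.simps sum.lessThan_Suc power_Suc
        add: sum.lessThan_Suc[of "\<lambda>i. area i ?\<tau> / z ^ i" n] algebra_simps)
  finally show ?thesis by (simp add: cesaro_def add_divide_distrib del: area.simps)
qed

text \<open>After \<open>j\<close> steps all descendants of positive length are states; the growth
  of total length by \<open>q ^ j\<close> is undone by \<open>j\<close> divisions by
  \<open>q\<close>.\<close>

lemma level_average:
  assumes "\<And>\<tau>. \<tau> \<in> states \<Longrightarrow> norm (\<Sum>i<n. area i \<tau> / z ^ i) \<le> K * len \<tau>"
    and "level j e w" "valid e a b"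
  shows "norm (\<Sum>i<n. area (i + j) (e, w, a, b) / z ^ i) \<le> K * (b - a)"
  using assms(2,3)
proof (induction j arbitrary: e w a b)
  case 0
  then show ?case using assms(1)[of "(e, w, a, b)"] by (simp add: states_def del: area.simps)
next
  case (Suc j)
  let ?\<tau> = "(e, w, a, b)"
  have 1: "(\<Sum>i<n. area (i + Suc j) ?\<tau> / z ^ i)
      = (\<Sum>i<n. (\<Sum>cc\<in>{..m} \<times> {..m}. area (i + j) (child ?\<tau> cc) / z ^ i)) / of_real q"
    by (simp add: area_Suc[OF Suc.prems(2)] sum_divide_distrib divide_divide_eq_left mult.commute
        del: area.simps child.simps)
  have 2: "(\<Sum>i<n. (\<Sum>cc\<in>{..m} \<times> {..m}. area (i + j) (child ?\<tau> cc) / z ^ i)) / of_real q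
      = (\<Sum>cc\<in>{..m} \<times> {..m}. \<Sum>i<n. area (i + j) (child ?\<tau> cc) / z ^ i) / of_real q"
    by (subst sum.swap) simp
  have "norm (\<Sum>i<n. area (i + Suc j) ?\<tau> / z ^ i) \<le> (\<Sum>cc\<in>{..m} \<times> {..m}. K * len (child ?\<tau> cc)) / norm (complex_of_real q)"
    unfolding 1 2 norm_divide
  proof (rule divide_right_mono, rule order_trans[OF norm_sum], rule sum_mono)
    fix cc assume "cc \<in> {..m} \<times> {..m}"
    then obtain c c' where cc: "cc = (c, c')" "c \<le> m" "c' \<le> m" by auto
    show "norm (\<Sum>i<n. area (i + j) (child ?\<tau> cc) / z ^ i) \<le> K * len (child ?\<tau> cc)"
    proof (cases "cut e a b c c' < cut e a b c (Suc c')")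
      case True
      then show ?thesis
        using Suc.IH[OF level_child[OF Suc.prems(1) cc(2,3), simplified] child_valid[OF Suc.prems(2) True cc(2,3)]]
        by (simp add: cc(1) del: area.simps)
    next
      case False
      then have "len (child ?\<tau> cc) = 0"
        using cut_mono[of c' "Suc c'" e a b c] by (simp add: cc(1))
      then show ?thesis by (simp add: area_eq_0)
    qed
  qed auto
  also have "\<dots> = K * (b - a)"
    using len_children[OF Suc.prems(2), of w] q_gt_1 by (simp add: sum_distrib_left[symmetric] del: child.simps)
  finally show ?case .
qed

lemma conj_map_h_nz: "conj_map h \<noteq> 0"
  using conj_map_eq_0_iff[OF h_Zq] h_pos by simp

lemma lip_bound: "lip i \<le> real m * (real i * norm z ^ i)"
proof -
  have "(\<Sum>l<i. norm z ^ l) \<le> (\<Sum>l<i. norm z ^ i)"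
    using z_norm by (intro sum_mono power_increasing) auto
  then show ?thesis unfolding lip_def by (intro mult_left_mono) auto
qed

lemma lip_mono: "i \<le> j \<Longrightarrow> lip i \<le> lip j"
  unfolding lip_def by (intro mult_left_mono sum_mono2) auto

text \<open>Here \<open>norm z < q\<close> enters: \<open>lip i\<close> grows at most like
  \<open>i * norm z ^ i\<close>.\<close>

lemma lip_small: "(\<lambda>J. lip (n + J) * (h / q ^ J)) \<longlonglongrightarrow> 0"
proof (rule tendsto_sandwich[of "\<lambda>_. 0" _ _ "\<lambda>J. real m * h * norm z ^ n * (real n * (norm z / q) ^ J + real J * (norm z / q) ^ J)"])
  have "norm (norm z / q) < 1" using norm_z_less q_gt_1 by simp
  then have "(\<lambda>J. real m * h * norm z ^ n * (real n * (norm z / q) ^ J + real J * (norm z / q) ^ J))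
      \<longlonglongrightarrow> real m * h * norm z ^ n * (real n * 0 + 0)"
    by (intro tendsto_intros LIMSEQ_power_zero powser_times_n_limit_0) auto
  then show "(\<lambda>J. real m * h * norm z ^ n * (real n * (norm z / q) ^ J + real J * (norm z / q) ^ J)) \<longlonglongrightarrow> 0"
    by simp
  show "\<forall>\<^sub>F J in sequentially. 0 \<le> lip (n + J) * (h / q ^ J)"
    using h_pos q_gt_1 by (intro always_eventually allI mult_nonneg_nonneg) (auto simp: lip_def sum_nonneg)
  have "lip (n + J) * (h / q ^ J) \<le> real m * (real (n + J) * norm z ^ (n + J)) * (h / q ^ J)" for J
    using lip_bound[of "n + J"] h_pos q_gt_1 by (intro mult_right_mono) auto
  also have "\<dots> J = real m * h * norm z ^ n * (real n * (norm z / q) ^ J + real J * (norm z / q) ^ J)" for J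
    by (simp add: power_add power_divide add_divide_distrib ring_distribs mult_ac)
  finally show "\<forall>\<^sub>F J in sequentially. lip (n + J) * (h / q ^ J)
      \<le> real m * h * norm z ^ n * (real n * (norm z / q) ^ J + real J * (norm z / q) ^ J)"
    by (intro always_eventually allI)
qed simp

text \<open>A shift by \<open>h / q ^ J\<close> of the unit interval moves the mean of its digit functional only at
  the two ends, so that \<open>- z ^ i * conj_map h\<close> is almost the mean of the functional on the states.\<close>
lemma cesaro_lower_bound:
  assumes n: "n > 0"
  shows "\<exists>\<tau>\<in>states. norm (conj_map h) / 4 * len \<tau> \<le> norm (cesaro n \<tau>)"
proof (rule ccontr)
  assume "\<not> ?thesis"
  then have small: "norm (\<Sum>i<n. area i \<tau> / z ^ i) \<le> real n * (norm (conj_map h) / 4) * len \<tau>" if "\<tau> \<in> states" for \<tau>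
    using that n by (force simp: cesaro_def norm_divide not_le field_simps)
  have "\<forall>\<^sub>F J in sequentially. lip (n + J) * (h / q ^ J) < norm (conj_map h) / 8"
    using lip_small[of n] conj_map_h_nz by (intro order_tendstoD) auto
  moreover have "(\<lambda>J. h / q ^ J) \<longlonglongrightarrow> 0"
    using tendsto_mult_right_zero[OF LIMSEQ_inverse_realpow_zero[OF q_gt_1], of h] by (simp add: field_simps)
  then have "\<forall>\<^sub>F J in sequentially. h / q ^ J < 1 / 4"
    by (intro order_tendstoD) auto
  ultimately have "\<forall>\<^sub>F J in sequentially. lip (n + J) * (h / q ^ J) < norm (conj_map h) / 8 \<and> h / q ^ J < 1 / 4"
    by (rule eventually_conj)
  then obtain J where J: "lip (n + J) * (h / q ^ J) < norm (conj_map h) / 8" "h / q ^ J < 1 / 4"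
    by (auto simp: eventually_sequentially)
  define \<epsilon> where "\<epsilon> = h / q ^ J"
  have eps: "0 < \<epsilon>" "\<epsilon> < 1 / 4" using J h_pos q_gt_1 by (auto simp: \<epsilon>_def)
  \<comment> \<open>The pairs \<open>(x, x + \<epsilon>)\<close>, with \<open>y = 0\<close> and
    \<open>i = 0\<close> at level \<open>J\<close>.\<close>
  let ?w = "- (conj_map h / z ^ J)"
  have lev: "level J (- \<epsilon>) ?w"
    unfolding level_def \<epsilon>_def using Y_0 conj_map_of_int[of 0] by (intro bexI[of _ 0] exI[of _ 0]) auto
  have v: "valid (- \<epsilon>) 0 (1 - \<epsilon>)"
    using eps Y_0 Y_1 by (simp add: valid_def)
  \<comment> \<open>The integrals over \<open>[0, 1 - \<epsilon>]\<close> and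
    \<open>[\<epsilon>, 1]\<close> cancel on the overlap, leaving two end pieces of length
    \<open>\<epsilon>\<close>.\<close>
  have A: "area (i + J) (- \<epsilon>, ?w, 0, 1 - \<epsilon>) / z ^ i =
      - (conj_map h * of_real (1 - \<epsilon>)) + ((psi (i + J) 1 - psi (i + J) (1 - \<epsilon>)) - (psi (i + J) \<epsilon> - psi (i + J) 0)) / z ^ i" for i
    using z_nz by (simp add: power_add field_simps)
  have B: "norm (((psi (i + J) 1 - psi (i + J) (1 - \<epsilon>)) - (psi (i + J) \<epsilon> - psi (i + J) 0)) / z ^ i) \<le> norm (conj_map h) / 4"
    if "i < n" for i
  proof -
    have "norm (((psi (i + J) 1 - psi (i + J) (1 - \<epsilon>)) - (psi (i + J) \<epsilon> - psi (i + J) 0)) / z ^ i)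
        \<le> norm ((psi (i + J) 1 - psi (i + J) (1 - \<epsilon>)) - (psi (i + J) \<epsilon> - psi (i + J) 0)) / 1"
      unfolding norm_divide norm_power using z_norm z_nz by (intro divide_left_mono) (auto simp: one_le_power)
    also have "\<dots> \<le> lip (i + J) * \<epsilon> + lip (i + J) * \<epsilon>"
    proof -
      have "norm (psi (i + J) 1 - psi (i + J) (1 - \<epsilon>)) \<le> lip (i + J) * \<epsilon>"
        "norm (psi (i + J) \<epsilon> - psi (i + J) 0) \<le> lip (i + J) * \<epsilon>"
        using psi_lipschitz[of "1 - \<epsilon>" 1 "i + J"] psi_lipschitz[of 0 \<epsilon> "i + J"] eps by simp_all
      then show ?thesis
        using norm_triangle_ineq4[of "psi (i + J) 1 - psi (i + J) (1 - \<epsilon>)" "psi (i + J) \<epsilon> - psi (i + J) 0"]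
        by linarith
    qed
    also have "\<dots> \<le> 2 * (lip (n + J) * \<epsilon>)"
      using mult_right_mono[OF lip_mono[of "i + J" "n + J"], of \<epsilon>] that eps by simp
    also have "\<dots> \<le> norm (conj_map h) / 4" using J(1) unfolding \<epsilon>_def by linarith
    finally show ?thesis .
  qed
  let ?r = "\<lambda>i. ((psi (i + J) 1 - psi (i + J) (1 - \<epsilon>)) - (psi (i + J) \<epsilon> - psi (i + J) 0)) / z ^ i"
  have S: "(\<Sum>i<n. area (i + J) (- \<epsilon>, ?w, 0, 1 - \<epsilon>) / z ^ i) = - (of_nat n * (conj_map h * of_real (1 - \<epsilon>))) + (\<Sum>i<n. ?r i)"
    unfolding A by (simp add: sum.distrib sum_subtractf sum_negf)
  have "norm (\<Sum>i<n. ?r i) \<le> (\<Sum>i<n. norm (conj_map h) / 4)"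
    by (intro order_trans[OF norm_sum] sum_mono B) simp
  then have "real n * (norm (conj_map h) * (1 - \<epsilon>)) - real n * (norm (conj_map h) / 4)
      \<le> norm (\<Sum>i<n. area (i + J) (- \<epsilon>, ?w, 0, 1 - \<epsilon>) / z ^ i)"
    unfolding S using norm_triangle_ineq2[of "of_nat n * (conj_map h * of_real (1 - \<epsilon>))" "\<Sum>i<n. ?r i"] eps
    by (simp add: norm_mult norm_minus_commute del: of_real_diff)
  also have "\<dots> \<le> real n * (norm (conj_map h) / 4) * (1 - \<epsilon> - 0)"
    using level_average[OF small lev v] .
  \<comment> \<open>As \<open>\<epsilon> < 1 / 4\<close>, the last factor exceeds
    \<open>9 / 16 - 1 / 4\<close>.\<close>
  finally have "real n * norm (conj_map h) * (3 / 4 * (1 - \<epsilon>) - 1 / 4) \<le> 0"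
    by (simp add: algebra_simps)
  moreover have "real n * norm (conj_map h) * (3 / 4 * (1 - \<epsilon>) - 1 / 4) > 0"
    using n conj_map_h_nz eps by (intro mult_pos_pos) auto
  ultimately show False by simp
qed

lemma limit_cesaro_exists:
  obtains r l where "strict_mono (r :: nat \<Rightarrow> nat)" "\<And>\<tau>. \<tau> \<in> states \<Longrightarrow> (\<lambda>n. cesaro (r n) \<tau>) \<longlonglongrightarrow> l \<tau>"
proof -
  obtain M where M: "\<And>i \<tau>. \<tau> \<in> states \<Longrightarrow> norm (area i \<tau>) \<le> M * len \<tau>"
    using area_bound_obtains by metis
  have "bounded (range (\<lambda>n. cesaro n \<tau>))" if "\<tau> \<in> states" for \<tau>
    unfolding bounded_iff using cesaro_bound[of \<tau> "M * len \<tau>"] M[OF that] by auto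
  then show ?thesis
    using finite_convergent_subsequence[OF finite_states, of cesaro] that by blast
qed

text \<open>A limit of the Cesaro means is an eigenfunction with eigenvalue \<open>z\<close> of a finite Markov chain.
  By the maximum principle \<open>z\<close> is a root of unity, which a conjugate of \<open>q > 1\<close> cannot be.\<close>
theorem no_expanding_conjugate: False
proof -
  obtain r l where r: "strict_mono (r :: nat \<Rightarrow> nat)"
    and lim: "\<And>\<tau>. \<tau> \<in> states \<Longrightarrow> (\<lambda>n. cesaro (r n) \<tau>) \<longlonglongrightarrow> l \<tau>"
    using limit_cesaro_exists by blast
  obtain M where M: "\<And>i \<tau>. \<tau> \<in> states \<Longrightarrow> norm (area i \<tau>) \<le> M * len \<tau>"
    using area_bound_obtains by metis
  define nd where "nd = (\<lambda>\<tau>. {cc \<in> {..m} \<times> {..m}. len (child \<tau> cc) \<noteq> 0})"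
  have nd_states: "child \<tau> cc \<in> states" if "\<tau> \<in> states" "cc \<in> nd \<tau>" for \<tau> cc
    using that child_states by (cases \<tau>) (auto simp: nd_def)
  have fin_nd: "finite (nd \<tau>)" for \<tau> by (simp add: nd_def)
  have len_nd: "(\<Sum>cc\<in>nd \<tau>. len (child \<tau> cc)) = q * len \<tau>" if "\<tau> \<in> states" for \<tau>
  proof -
    obtain e w a b where \<tau>: "\<tau> = (e, w, a, b)" by (cases \<tau>)
    have "(\<Sum>cc\<in>nd \<tau>. len (child \<tau> cc)) = (\<Sum>cc\<in>{..m} \<times> {..m}. len (child \<tau> cc))"
      by (intro sum.mono_neutral_left) (auto simp: nd_def)
    then show ?thesis using len_children[of e a b w] states_valid that by (simp add: \<tau> del: child.simps)
  qed
  have eig: "(\<Sum>cc\<in>nd \<tau>. l (child \<tau> cc)) = of_real q * z * l \<tau>" if \<tau>s: "\<tau> \<in> states" for \<tau>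
  proof -
    obtain e w a b where \<tau>: "\<tau> = (e, w, a, b)" by (cases \<tau>)
    have v: "valid e a b" using \<tau>s states_valid \<tau> by simp
    have "(\<Sum>cc\<in>nd \<tau>. cesaro n (child \<tau> cc)) = (\<Sum>cc\<in>{..m} \<times> {..m}. cesaro n (child \<tau> cc))" for n
      by (intro sum.mono_neutral_left) (auto simp: nd_def cesaro_def area_eq_0 simp del: child.simps)
    then have eq: "(\<Sum>cc\<in>nd \<tau>. cesaro n (child \<tau> cc)) =
        of_real q * z * (cesaro n \<tau> + (area n \<tau> / z ^ n - area 0 \<tau>) / of_nat n)" if "n > 0" for n
      using cesaro_children[OF v that, of w] by (simp add: \<tau> del: child.simps area.simps)
    have "(\<lambda>n. (area n \<tau> / z ^ n - area 0 \<tau>) / of_nat n) \<longlonglongrightarrow> 0"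
    proof (rule Lim_null_comparison)
      have bnd: "norm (area n \<tau> / z ^ n - area 0 \<tau>) \<le> 2 * (M * len \<tau>)" for n
      proof -
        have "norm (area n \<tau> / z ^ n) \<le> norm (area n \<tau>) / 1"
          unfolding norm_divide norm_power using z_norm z_nz
          by (intro divide_left_mono) (auto simp: one_le_power)
        then show ?thesis
          using norm_triangle_ineq4[of "area n \<tau> / z ^ n" "area 0 \<tau>"] M[OF \<tau>s, of n] M[OF \<tau>s, of 0]
          by linarith
      qed
      show "\<forall>\<^sub>F n in sequentially. norm ((area n \<tau> / z ^ n - area 0 \<tau>) / of_nat n)
          \<le> 2 * (M * len \<tau>) / real n"
        unfolding norm_divide norm_of_nat
        by (intro always_eventually allI divide_right_mono) (use bnd in auto)
      show "(\<lambda>n. 2 * (M * len \<tau>) / real n) \<longlonglongrightarrow> 0"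
        by (rule lim_const_over_n)
    qed
    from LIMSEQ_subseq_LIMSEQ[OF this r]
    have rest: "(\<lambda>n. (area (r n) \<tau> / z ^ r n - area 0 \<tau>) / of_nat (r n)) \<longlonglongrightarrow> 0" by (simp add: o_def)
    have lim1: "(\<lambda>n. \<Sum>cc\<in>nd \<tau>. cesaro (r n) (child \<tau> cc)) \<longlonglongrightarrow> (\<Sum>cc\<in>nd \<tau>. l (child \<tau> cc))"
      using lim nd_states[OF \<tau>s] by (intro tendsto_sum) blast
    have lim2: "(\<lambda>n. of_real q * z * (cesaro (r n) \<tau> + (area (r n) \<tau> / z ^ r n - area 0 \<tau>) / of_nat (r n)))
        \<longlonglongrightarrow> of_real q * z * (l \<tau> + 0)"
      by (intro tendsto_intros lim \<tau>s rest)
    have "\<forall>\<^sub>F n in sequentially. of_real q * z * (cesaro (r n) \<tau> + (area (r n) \<tau> / z ^ r n - area 0 \<tau>) / of_nat (r n))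
        = (\<Sum>cc\<in>nd \<tau>. cesaro (r n) (child \<tau> cc))"
      using eventually_gt_at_top[of 0]
    proof eventually_elim
      case (elim n)
      then show ?case using eq[of "r n"] seq_suble[OF r, of n] by auto
    qed
    from LIMSEQ_unique[OF lim1 Lim_transform_eventually[OF lim2 this]] show ?thesis by simp
  qed
  \<comment> \<open>By \<open>len_nd\<close> the ratios
    \<open>len (child \<tau> cc) / (q * len \<tau>)\<close> are transition probabilities, and
    \<open>eig\<close> says that the mean of \<open>phi\<close> over the children is
    \<open>z * phi \<tau>\<close>.\<close>
  define phi where "phi = (\<lambda>\<tau>. l \<tau> / of_real (len \<tau>))"
  have phi: "l \<tau> = phi \<tau> * of_real (len \<tau>)" if "\<tau> \<in> states" for \<tau>
    using len_states[OF that] by (simp add: phi_def)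
  define \<Lambda> where "\<Lambda> = Max ((norm \<circ> phi) ` states)"
  have le_Max: "norm (phi \<tau>) \<le> \<Lambda>" if "\<tau> \<in> states" for \<tau>
    unfolding \<Lambda>_def using finite_states that by (intro Max_ge) auto
  \<comment> \<open>The state in \<open>cesaro_lower_bound\<close> depends on \<open>n\<close>, but
    there are finitely many states, so limits that all vanish would violate it for large
    \<open>n\<close>.\<close>
  have Lpos: "\<Lambda> > 0"
  proof (rule ccontr)
    assume "\<not> \<Lambda> > 0"
    then have l0: "l \<tau> = 0" if "\<tau> \<in> states" for \<tau>
      using le_Max[OF that] phi[OF that] by (smt (verit) mult_eq_0_iff norm_le_zero_iff)
    have "\<forall>\<tau>\<in>states. \<forall>\<^sub>F n in sequentially. norm (cesaro (r n) \<tau>) < norm (conj_map h) / 4 * len \<tau>"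
    proof
      fix \<tau> assume \<tau>: "\<tau> \<in> states"
      have "(\<lambda>n. norm (cesaro (r n) \<tau>)) \<longlonglongrightarrow> norm (l \<tau>)" by (intro tendsto_norm lim \<tau>)
      then show "\<forall>\<^sub>F n in sequentially. norm (cesaro (r n) \<tau>) < norm (conj_map h) / 4 * len \<tau>"
        by (rule order_tendstoD) (use l0[OF \<tau>] len_states[OF \<tau>] conj_map_h_nz in simp)
    qed
    then have "\<forall>\<^sub>F n in sequentially. \<forall>\<tau>\<in>states. norm (cesaro (r n) \<tau>) < norm (conj_map h) / 4 * len \<tau>"
      by (intro eventually_ball_finite finite_states)
    then obtain N where N: "\<And>n \<tau>. n \<ge> N \<Longrightarrow> \<tau> \<in> states \<Longrightarrow> norm (cesaro (r n) \<tau>) < norm (conj_map h) / 4 * len \<tau>"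
      by (auto simp: eventually_sequentially)
    have "r (Suc N) > 0" using seq_suble[OF r, of "Suc N"] by simp
    from cesaro_lower_bound[OF this] N[of "Suc N"] show False by force
  qed
  have "states \<noteq> {}" using cesaro_lower_bound[of 1] by auto
  then obtain \<tau>0 where \<tau>0: "\<tau>0 \<in> states" "norm (phi \<tau>0) = \<Lambda>"
    using Max_in[of "(norm \<circ> phi) ` states"] finite_states unfolding \<Lambda>_def by fastforce
  \<comment> \<open>Maximum principle: where \<open>norm (phi \<tau>)\<close> is maximal,
    \<open>norm z \<ge> 1\<close> forces equality in the triangle inequality for the mean, so a
    child has the value \<open>z * phi \<tau>\<close>.\<close>
  have step: "\<exists>\<tau>'\<in>states. phi \<tau>' = z * phi \<tau>" if \<tau>: "\<tau> \<in> states" "norm (phi \<tau>) = \<Lambda>" for \<tau>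
  proof -
    have ql: "q * len \<tau> > 0" using len_states[OF \<tau>(1)] q_gt_1 by simp
    have lc: "norm (l (child \<tau> cc)) \<le> \<Lambda> * len (child \<tau> cc)" if "cc \<in> nd \<tau>" for cc
      using phi[OF nd_states[OF \<tau>(1) that]] le_Max[OF nd_states[OF \<tau>(1) that]]
        len_states[OF nd_states[OF \<tau>(1) that]]
      by (simp add: norm_mult mult_right_mono)
    have sum: "(\<Sum>cc\<in>nd \<tau>. l (child \<tau> cc)) = (z * phi \<tau>) * of_real (\<Sum>cc\<in>nd \<tau>. len (child \<tau> cc))"
      unfolding eig[OF \<tau>(1)] len_nd[OF \<tau>(1)] phi[OF \<tau>(1)] by (simp add: mult_ac)
    have "norm (z * phi \<tau>) * (q * len \<tau>) = norm (\<Sum>cc\<in>nd \<tau>. l (child \<tau> cc))"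
      unfolding sum len_nd[OF \<tau>(1)] using abs_of_pos[OF ql] by (simp add: norm_mult abs_mult)
    also have "\<dots> \<le> (\<Sum>cc\<in>nd \<tau>. \<Lambda> * len (child \<tau> cc))"
      by (intro order_trans[OF norm_sum] sum_mono lc)
    also have "\<dots> = \<Lambda> * (q * len \<tau>)" by (simp add: sum_distrib_left[symmetric] len_nd[OF \<tau>(1)])
    finally have "norm (z * phi \<tau>) \<le> \<Lambda>" using ql by (rule mult_right_le_imp_le)
    then have "norm z * \<Lambda> \<le> 1 * \<Lambda>" using \<tau>(2) by (simp add: norm_mult)
    then have z1: "norm z = 1" using Lpos z_norm by simp
    have "nd \<tau> \<noteq> {}" using len_nd[OF \<tau>(1)] ql by auto
    then obtain cc where cc: "cc \<in> nd \<tau>" by blast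
    have "l (child \<tau> cc) = (z * phi \<tau>) * of_real (len (child \<tau> cc))"
    proof (rule equality_in_weighted_sum[OF fin_nd[of \<tau>] _ sum cc])
      show "norm (l (child \<tau> cc)) \<le> norm (z * phi \<tau>) * len (child \<tau> cc)" if "cc \<in> nd \<tau>" for cc
        using lc[OF that] \<tau>(2) z1 by (simp add: norm_mult)
      show "len (child \<tau> cc) \<ge> 0" using len_states[OF nd_states[OF \<tau>(1) cc]] by simp
    qed
    then have "phi (child \<tau> cc) = z * phi \<tau>"
      using len_states[OF nd_states[OF \<tau>(1) cc]] by (simp add: phi_def)
    then show ?thesis using nd_states[OF \<tau>(1) cc] by blast
  qed
  have z1: "norm z = 1"
  proof -
    obtain \<tau>' where "\<tau>' \<in> states" "phi \<tau>' = z * phi \<tau>0" using step[OF \<tau>0] by blast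
    then have "norm z * \<Lambda> \<le> 1 * \<Lambda>" using le_Max[of \<tau>'] \<tau>0 by (simp add: norm_mult)
    then show ?thesis using Lpos z_norm by simp
  qed
  have orb: "\<exists>\<tau>\<in>states. phi \<tau> = z ^ n * phi \<tau>0" for n
  proof (induction n)
    case (Suc n)
    then obtain \<tau> where \<tau>: "\<tau> \<in> states" "phi \<tau> = z ^ n * phi \<tau>0" by blast
    then have "norm (phi \<tau>) = \<Lambda>" using z1 \<tau>0 by (simp add: norm_mult norm_power)
    from step[OF \<tau>(1) this] \<tau> show ?case by (auto simp: mult.assoc)
  qed (use \<tau>0 in auto)
  have "z ^ n * phi \<tau>0 \<in> phi ` states" for n
    using orb[of n] by (metis imageI)
  \<comment> \<open>Repetition among the values \<open>z ^ n * phi \<tau>0\<close> makes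
    \<open>z\<close> a root of unity, and then \<open>q\<close> would be one too.\<close>
  then have "finite (range (\<lambda>n. z ^ n * phi \<tau>0))"
    by (intro finite_subset[OF _ finite_imageI[OF finite_states, of phi]]) auto
  then have "\<not> inj (\<lambda>n. z ^ n * phi \<tau>0)" using finite_imageD infinite_UNIV_nat by blast
  then obtain i j where "i < j" "z ^ i * phi \<tau>0 = z ^ j * phi \<tau>0"
    by (auto simp: inj_def) (metis linorder_neqE_nat)
  moreover have "phi \<tau>0 \<noteq> 0" using \<tau>0 Lpos by auto
  ultimately have "z ^ (j - i) = 1"
    using z_nz by (simp add: power_diff)
  then have "poly (map_poly of_int (monom 1 (j - i) - 1)) z = 0"
    by (simp add: ring_embedding.map_poly_diff[OF ring_embedding_of_int] map_poly_monom poly_monom)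
  then have "poly (map_poly of_int (monom 1 (j - i) - 1)) q = 0"
    by (simp only: conj)
  then have "q ^ (j - i) = 1"
    by (simp add: ring_embedding.map_poly_diff[OF ring_embedding_of_int] map_poly_monom poly_monom)
  moreover have "q ^ (j - i) > 1" using q_gt_1 \<open>i < j\<close> by (simp add: one_less_power)
  ultimately show False by simp
qed

end

section \<open>Pisot numbers have locally finite spectra\<close>

lemma finite_polys_bounded:
  fixes S :: "'a :: zero set"
  assumes "finite S"
  shows "finite {p :: 'a poly. (\<forall>i. coeff p i \<in> S) \<and> (\<forall>i\<ge>n. coeff p i = 0)}"
proof (rule finite_subset)
  show "finite (Poly ` {xs. set xs \<subseteq> S \<and> length xs = n})"
    using finite_lists_length_eq[OF assms, of n] by simp
  show "{p :: 'a poly. (\<forall>i. coeff p i \<in> S) \<and> (\<forall>i\<ge>n. coeff p i = 0)} \<subseteq> Poly ` {xs. set xs \<subseteq> S \<and> length xs = n}"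
  proof
    fix p :: "'a poly" assume p: "p \<in> {p. (\<forall>i. coeff p i \<in> S) \<and> (\<forall>i\<ge>n. coeff p i = 0)}"
    have "p = Poly (map (coeff p) [0..<n])"
      using p by (intro poly_eqI) (auto simp: nth_default_def)
    then show "p \<in> Poly ` {xs. set xs \<subseteq> S \<and> length xs = n}"
      using p by (intro image_eqI) auto
  qed
qed

text \<open>The value and the quotient coefficients are the intermediate results of Horner's scheme;
  each is at most \<open>K\<close> plus \<open>norm w\<close> times the preceding one, a geometric
  series bounded independently of the degree.\<close>

lemma synthetic_div_bound_contracting:
  fixes p :: "complex poly"
  assumes w: "norm w < 1" and "\<And>i. norm (coeff p i) \<le> K"
  shows "norm (poly p w) \<le> K / (1 - norm w) \<and> (\<forall>i. norm (coeff (synthetic_div p w) i) \<le> K / (1 - norm w))"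
  using assms(2)
proof (induction p)
  case 0
  then show ?case using w by (auto simp: order_trans[OF norm_ge_zero])
next
  case (pCons a p)
  have pK: "norm (coeff p i) \<le> K" for i using pCons.prems[of "Suc i"] by simp
  note IH = pCons.IH[OF pK]
  have "norm (poly (pCons a p) w) \<le> norm a + norm w * norm (poly p w)"
    using norm_triangle_ineq[of a "w * poly p w"] by (simp add: norm_mult)
  also have "\<dots> \<le> K + norm w * (K / (1 - norm w))"
    using IH pCons.prems[of 0] by (intro add_mono mult_left_mono) auto
  also have "\<dots> = K / (1 - norm w)" using w by (simp add: field_simps)
  finally show ?case using IH by (auto simp: coeff_pCons split: nat.split)
qed

text \<open>Horner's scheme run backwards from the value at \<open>q\<close>: each inner value
  arises by subtracting a coefficient and dividing by \<open>q\<close>, and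
  \<open>R + K \<le> q * R\<close> preserves the bound \<open>R\<close>.\<close>

lemma synthetic_div_bound_expanding:
  fixes p :: "complex poly"
  assumes q: "q > 1" and "\<And>i. norm (coeff p i) \<le> K" and R: "K / (q - 1) \<le> R" "norm (poly p (of_real q)) \<le> R"
  shows "norm (coeff (synthetic_div p (of_real q)) i) \<le> R"
  using assms(2) R(2)
proof (induction p arbitrary: i)
  case 0
  then show ?case by (simp add: order_trans[OF norm_ge_zero R(2)])
next
  case (pCons a p)
  have pK: "norm (coeff p i) \<le> K" for i using pCons.prems(1)[of "Suc i"] by simp
  have "of_real q * poly p (of_real q) = poly (pCons a p) (of_real q) - a" by simp
  then have "q * norm (poly p (of_real q)) = norm (poly (pCons a p) (of_real q) - a)"
    using q by (metis abs_of_pos less_trans norm_mult norm_of_real zero_less_one)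
  also have "\<dots> \<le> R + K"
    using norm_triangle_ineq4[of "poly (pCons a p) (of_real q)" a] pCons.prems(2) pCons.prems(1)[of 0] by simp
  also have "\<dots> \<le> q * R" using R(1) q by (simp add: field_simps)
  finally have *: "norm (poly p (of_real q)) \<le> R" using q by simp
  then show ?case using pCons.IH[OF pK *] by (auto simp: coeff_pCons split: nat.split)
qed

lemma linear_factor_remainder_bound:
  fixes r :: "complex poly"
  assumes "\<And>i. norm (coeff r i) \<le> K" "norm c \<le> K'" "\<And>i. i \<ge> n \<Longrightarrow> coeff r i = 0"
  shows "norm (coeff ([:- w, 1:] * r + [:c:]) i) \<le> K + norm w * K + K'"
    "i \<ge> Suc n \<Longrightarrow> coeff ([:- w, 1:] * r + [:c:]) i = 0"
proof -
  have K: "K \<ge> 0" "K' \<ge> 0" using order_trans[OF norm_ge_zero] assms(1,2) by blast+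
  have c: "coeff ([:- w, 1:] * r + [:c:]) i = coeff (pCons 0 r) i + (- (w * coeff r i)) + coeff [:c:] i"
    by (cases i) (simp_all add: coeff_pCons)
  have "norm (coeff (pCons 0 r) i) \<le> K" "norm (coeff [:c:] i) \<le> K'"
    using assms K by (auto simp: coeff_pCons split: nat.split)
  moreover have "norm (- (w * coeff r i)) \<le> norm w * K"
    using assms by (simp add: norm_mult mult_left_mono)
  ultimately show "norm (coeff ([:- w, 1:] * r + [:c:]) i) \<le> K + norm w * K + K'"
    unfolding c by (intro norm_triangle_mono) 
  show "coeff ([:- w, 1:] * r + [:c:]) i = 0" if "i \<ge> Suc n"
    unfolding c using assms(3) that by (auto simp: coeff_pCons split: nat.split)
qed

text \<open>Linear factors are split off one at a time, with a bound independent of \<open>p\<close>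
  and its degree.\<close>

lemma bounded_remainder_contracting:
  assumes "\<And>w. w \<in> set ws \<Longrightarrow> norm w < 1"
  shows "\<exists>K'. \<forall>p :: complex poly. (\<forall>i. norm (coeff p i) \<le> K) \<longrightarrow>
    (\<exists>r s. p = (\<Prod>w\<leftarrow>ws. [:- w, 1:]) * s + r \<and> (\<forall>i. norm (coeff r i) \<le> K') \<and> (\<forall>i\<ge>length ws. coeff r i = 0))"
  using assms
proof (induction ws arbitrary: K)
  case Nil
  have "p = (\<Prod>w\<leftarrow>[]. [:- w, 1:]) * p + 0" for p :: "complex poly" by simp
  then show ?case by (intro exI[of _ 0] allI impI exI conjI) auto
next
  case (Cons w ws)
  let ?K1 = "K / (1 - norm w)"
  obtain K2 where K2: "\<And>p :: complex poly. (\<forall>i. norm (coeff p i) \<le> ?K1) \<Longrightarrow>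
    \<exists>r s. p = (\<Prod>w\<leftarrow>ws. [:- w, 1:]) * s + r \<and> (\<forall>i. norm (coeff r i) \<le> K2) \<and> (\<forall>i\<ge>length ws. coeff r i = 0)"
    using Cons.IH[of ?K1] Cons.prems by auto
  show ?case
  proof (intro exI[of _ "K2 + norm w * K2 + ?K1"] allI impI)
    fix p :: "complex poly" assume p: "\<forall>i. norm (coeff p i) \<le> K"
    note s1 = synthetic_div_bound_contracting[of w p K]
    then obtain r s where rs: "synthetic_div p w = (\<Prod>w\<leftarrow>ws. [:- w, 1:]) * s + r"
      "\<forall>i. norm (coeff r i) \<le> K2" "\<forall>i\<ge>length ws. coeff r i = 0"
      using K2[of "synthetic_div p w"] Cons.prems p by auto
    have "p = [:- w, 1:] * synthetic_div p w + [:poly p w:]"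
      by (rule synthetic_div_correct'[symmetric])
    also have "\<dots> = (\<Prod>w\<leftarrow>w # ws. [:- w, 1:]) * s + ([:- w, 1:] * r + [:poly p w:])"
      unfolding rs(1) by (simp add: algebra_simps)
    finally have "p = (\<Prod>w\<leftarrow>w # ws. [:- w, 1:]) * s + ([:- w, 1:] * r + [:poly p w:])" .
    moreover have "norm (poly p w) \<le> ?K1" using s1 Cons.prems p by simp
    ultimately show "\<exists>r s. p = (\<Prod>w\<leftarrow>w # ws. [:- w, 1:]) * s + r \<and>
        (\<forall>i. norm (coeff r i) \<le> K2 + norm w * K2 + ?K1) \<and> (\<forall>i\<ge>length (w # ws). coeff r i = 0)"
      using linear_factor_remainder_bound[where r = r and K = K2 and c = "poly p w" and K' = ?K1 and n = "length ws" and w = w] rs(2,3)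
      by (intro exI[of _ "[:- w, 1:] * r + [:poly p w:]"] exI[of _ s]) auto
  qed
qed

lemma mod_sum_poly: "(\<Sum>i\<in>A. f i) mod p = (\<Sum>i\<in>A. f i mod (p :: 'a :: field poly))"
  by (induction A rule: infinite_finite_induct) (simp_all add: poly_mod_add_left)

lemma common_denominator:
  assumes "finite (C :: rat set)"
  shows "\<exists>N :: int. N > 0 \<and> (\<forall>c\<in>C. of_int N * c \<in> \<int>)"
  using assms
proof (induction C)
  case empty
  then show ?case by (intro exI[of _ 1]) auto
next
  case (insert c C)
  then obtain N :: int where N: "N > 0" "\<forall>c\<in>C. of_int N * c \<in> \<int>" by blast
  obtain a b where ab: "quotient_of c = (a, b)" by (cases "quotient_of c")
  then have b: "b > 0" "c = of_int a / of_int b"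
    using quotient_of_denom_pos quotient_of_div by blast+
  have "of_int (N * b) * x \<in> \<int>" if "x \<in> insert c C" for x
  proof (cases "x = c")
    case True
    then have "of_int (N * b) * x = of_int (N * a)" using b by simp
    then show ?thesis by (metis Ints_of_int)
  next
    case False
    then have "of_int N * x \<in> \<int>" using N(2) that by blast
    then have "of_int b * (of_int N * x) \<in> \<int>" by (rule Ints_mult[OF Ints_of_int])
    then show ?thesis by (simp add: mult_ac)
  qed
  then show ?case using N b by (intro exI[of _ "N * b"]) auto
qed

text \<open>A monic polynomial of least degree vanishing at \<open>x\<close>; its derivative has
  smaller degree and cannot vanish there, so \<open>x\<close> is a simple root.\<close>

lemma min_poly_exists:
  assumes "algebraic (x :: real)"
  obtains p where "is_min_poly p x" "poly (map_poly of_rat (pderiv p)) x \<noteq> 0"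
proof -
  interpret R: ring_embedding "of_rat :: rat \<Rightarrow> real" by (rule ring_embedding_of_rat)
  define V where "V = (\<lambda>d :: rat poly. d \<noteq> 0 \<and> poly (map_poly of_rat d) x = 0)"
  obtain g :: "int poly" where g: "g \<noteq> 0" "poly (map_poly of_int g) x = 0"
    using assms by (rule algebraicE')
  have "map_poly of_int g \<noteq> (0 :: rat poly)"
    using g(1) by (metis coeff_map_poly coeff_0 leading_coeff_0_iff of_int_eq_0_iff of_int_0)
  then have "V (map_poly of_int g)" using g by (simp add: V_def poly_of_rat_int)
  then have "\<exists>d. V d \<and> (\<forall>e. V e \<longrightarrow> degree d \<le> degree e)" by (rule ex_has_least_nat)
  then obtain d where d: "V d" "\<And>e. V e \<Longrightarrow> degree d \<le> degree e" by blast
  define p where "p = smult (inverse (lead_coeff d)) d"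
  have l: "lead_coeff p = 1" "degree p = degree d" using d(1) by (auto simp: p_def V_def)
  have Vp: "V p" using d(1) by (auto simp: p_def V_def R.map_poly_smult_hom)
  have deg: "degree p > 0"
  proof (rule ccontr)
    assume "\<not> degree p > 0"
    then obtain c where "p = [:c:]" by (auto elim: degree_eq_zeroE)
    then show False using Vp by (auto simp: V_def map_poly_pCons)
  qed
  have unit: "is_unit b" if "p = a * b" "poly (map_poly of_rat a) x = 0" for a b
  proof -
    have "a \<noteq> 0" "b \<noteq> 0" using that Vp by (auto simp: V_def)
    moreover have "degree p \<le> degree a" using d(2)[of a] that \<open>a \<noteq> 0\<close> l by (simp add: V_def)
    ultimately have "degree b = 0" using that by (simp add: degree_mult_eq)
    then show ?thesis using \<open>b \<noteq> 0\<close> by (simp add: is_unit_iff_degree)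
  qed
  have "irreducible p"
  proof (rule irreducibleI)
    show "p \<noteq> 0" using Vp by (simp add: V_def)
    show "\<not> is_unit p" using deg is_unit_iff_degree[of p] Vp by (auto simp: V_def)
    fix a b assume ab: "p = a * b"
    then have "poly (map_poly of_rat a) x = 0 \<or> poly (map_poly of_rat b) x = 0"
      using Vp by (simp add: V_def R.map_poly_mult)
    then show "is_unit a \<or> is_unit b" using unit[of a b] unit[of b a] ab by (auto simp: mult.commute)
  qed
  then have "is_min_poly p x" using Vp l by (simp add: is_min_poly_def V_def)
  moreover have "poly (map_poly of_rat (pderiv p)) x \<noteq> 0"
  proof
    assume *: "poly (map_poly of_rat (pderiv p)) x = 0"
    have "pderiv p \<noteq> 0" using deg by (simp add: pderiv_eq_0_iff)
    then have "degree p \<le> degree (pderiv p)" using * d(2)[of "pderiv p"] l by (simp add: V_def)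
    then show False using deg by (simp add: degree_pderiv)
  qed
  ultimately show ?thesis by (rule that)
qed

section \<open>Finitely many remainders modulo the minimal polynomial\<close>

context spectrum
begin

lemma Y_poly:
  assumes "y \<in> Y"
  obtains P :: "int poly" where "y = poly (map_poly of_int P) q" "\<And>i. \<bar>coeff P i\<bar> \<le> int m"
proof -
  have "\<exists>P :: int poly. y = poly (map_poly of_int P) q \<and> (\<forall>i. \<bar>coeff P i\<bar> \<le> int m)"
    using assms
  proof (induction rule: Y_induct)
    case zero
    then show ?case by (intro exI[of _ 0]) auto
  next
    case (step y c)
    then obtain P :: "int poly" where "y = poly (map_poly of_int P) q" "\<forall>i. \<bar>coeff P i\<bar> \<le> int m" by blast
    then show ?case using step.hyps(2)
      by (intro exI[of _ "pCons c P"]) (auto simp: map_poly_pCons coeff_pCons split: nat.split)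
  qed
  then show ?thesis using that by blast
qed

lemma finite_Y_pisot:
  assumes "pisot q"
  shows "finite (Y \<inter> {-R..R})"
proof -
  interpret RC: ring_embedding "of_rat :: rat \<Rightarrow> complex" by (rule ring_embedding_of_rat)
  interpret RR: ring_embedding "of_rat :: rat \<Rightarrow> real" by (rule ring_embedding_of_rat)
  interpret IR: ring_embedding "of_int :: int \<Rightarrow> rat" by (rule ring_embedding_of_int)
  have ai: "algebraic_int q" using assms by (simp add: pisot_def)
  obtain \<mu> where \<mu>: "is_min_poly \<mu> q" "poly (map_poly of_rat (pderiv \<mu>)) q \<noteq> 0"
    using min_poly_exists algebraic_int_imp_algebraic[OF ai] by blast
  have \<mu>C: "is_min_poly \<mu> (of_real q :: complex)"
    using \<mu>(1) by (simp add: is_min_poly_def poly_of_rat_of_real)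
  define F where "F = (map_poly of_rat \<mu> :: complex poly)"
  have degF: "degree F = degree \<mu>" unfolding F_def by (rule degree_map_poly) simp
  have lcF: "lead_coeff F = 1" using \<mu> by (simp add: degF) (simp add: F_def coeff_map_poly is_min_poly_def)
  then have F0: "F \<noteq> 0" by auto
  have qF: "poly F (of_real q) = 0" using \<mu>C by (simp add: F_def is_min_poly_def)
  have "pderiv F = map_poly of_rat (pderiv \<mu>)"
    by (intro poly_eqI) (simp add: F_def coeff_pderiv coeff_map_poly RC.f_mult RC.f_add)
  then have "poly (pderiv F) (of_real q) \<noteq> 0" using \<mu>(2) by (simp add: poly_of_rat_of_real)
  \<comment> \<open>Simplicity of the root \<open>q\<close> ensures that the remaining roots differ
    from \<open>q\<close> and so have modulus below 1.\<close>
  then have ord: "order (of_real q) F = 1"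
    using order_root[of F "of_real q"] qF F0 order_pderiv[of F "of_real q"] order_root[of "pderiv F" "of_real q"]
    by auto
  have "complex_of_real q \<in># proots F" using qF F0 by simp
  then obtain A where A: "proots F = add_mset (of_real q) A" by (meson mset_add)
  have A_small: "norm w < 1" if "w \<in># A" for w
  proof -
    have "count (proots F) (of_real q) = 1" using ord F0 by simp
    then have "count A (of_real q) = 0" using A by simp
    then have "w \<noteq> of_real q" using that by (auto simp: count_eq_zero_iff)
    moreover have "w \<in># proots F" using that A by simp
    then have "poly F w = 0" using F0 by simp
    then have "alg_conjugate (of_real q) w" using \<mu>C by (auto simp: alg_conjugate_def F_def)
    ultimately show ?thesis using assms by (auto simp: pisot_def)
  qed
  obtain ws where ws: "mset ws = A" by (meson ex_mset)
  have Fprod: "F = [:- of_real q, 1:] * (\<Prod>w\<leftarrow>ws. [:- w, 1:])"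
  proof -
    have "F = (\<Prod>x\<in>#proots F. [:- x, 1:])"
      using complex_poly_decompose_multiset[of F] lcF by simp
    also have "\<dots> = [:- of_real q, 1:] * (\<Prod>x\<in>#A. [:- x, 1:])" by (simp add: A)
    also have "(\<Prod>x\<in>#A. [:- x, 1:]) = (\<Prod>w\<leftarrow>ws. [:- w, 1:])"
      by (simp add: ws[symmetric] prod_mset_prod_list flip: mset_map)
    finally show ?thesis .
  qed
  have lenws: "degree F = Suc (length ws)"
  proof -
    have "degree F = size (proots F)" by (simp add: size_proots_complex)
    then show ?thesis using ws A by (metis size_add_mset size_mset)
  qed
  \<comment> \<open>The second entry is the threshold required by
    \<open>synthetic_div_bound_expanding\<close>.\<close>
  define R' where "R' = max R (real m / (q - 1))"
  obtain K where K: "\<And>p :: complex poly. (\<forall>i. norm (coeff p i) \<le> R') \<Longrightarrow>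
    \<exists>r s. p = (\<Prod>w\<leftarrow>ws. [:- w, 1:]) * s + r \<and> (\<forall>i. norm (coeff r i) \<le> K) \<and> (\<forall>i\<ge>length ws. coeff r i = 0)"
  proof -
    have "norm w < 1" if "w \<in> set ws" for w using A_small that by (simp add: ws[symmetric])
    then show ?thesis using bounded_remainder_contracting[of ws R'] that by blast
  qed
  obtain g :: "int poly" where g: "poly (map_poly of_int g) q = 0" "lead_coeff g = 1"
    using ai by (auto simp: algebraic_int_altdef_ipoly)
  have g0: "g \<noteq> 0" using g(2) by auto
  \<comment> \<open>Reduction modulo the monic integer polynomial \<open>g\<close> leaves integer
    combinations of finitely many monomials; a common denominator of their remainders modulo
    \<open>\<mu>\<close> serves all of \<open>Y\<close>.\<close>
  have "finite (\<Union>i<degree g. range (coeff (monom 1 i mod \<mu>)))"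
  proof (intro finite_UN_I finite_lessThan)
    show "finite (range (coeff p))" for p :: "rat poly"
    proof (rule finite_subset)
      show "range (coeff p) \<subseteq> insert 0 (coeff p ` {..degree p})" using coeff_eq_0 by (force simp: not_le[symmetric])
    qed simp
  qed
  then obtain N :: int where N: "N > 0"
    "\<And>i j. i < degree g \<Longrightarrow> of_int N * coeff (monom 1 i mod \<mu>) j \<in> \<int>"
    using common_denominator by (metis (no_types, lifting) UN_I lessThan_iff rangeI)
  define K' where "K' = K + norm (complex_of_real q) * K + R'"
  define S where "S = {c :: rat. of_int N * c \<in> \<int> \<and> \<bar>real_of_rat c\<bar> \<le> K'}"
  have finS: "finite S"
  proof (rule finite_subset)
    show "S \<subseteq> (\<lambda>k. of_int k / of_int N) ` {- \<lceil>of_int N * K'\<rceil> .. \<lceil>of_int N * K'\<rceil>}"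
    proof
      fix c assume c: "c \<in> S"
      then obtain k where k: "of_int N * c = of_int k" by (auto simp: S_def elim: Ints_cases)
      have "real_of_int k = of_int N * of_rat c"
        using arg_cong[OF k, of "of_rat :: rat \<Rightarrow> real"] by (simp add: of_rat_mult)
      then have "\<bar>real_of_int k\<bar> = of_int N * \<bar>real_of_rat c\<bar>" using N by (simp add: abs_mult)
      also have "\<dots> \<le> of_int N * K'" using c N by (intro mult_left_mono) (auto simp: S_def)
      finally have "\<bar>real_of_int k\<bar> \<le> of_int N * K'" .
      then have "k \<in> {- \<lceil>of_int N * K'\<rceil> .. \<lceil>of_int N * K'\<rceil>}" by simp linarith
      moreover have "c = of_int k / of_int N" using k N by (simp add: field_simps)
      ultimately show "c \<in> (\<lambda>k. of_int k / of_int N) ` {- \<lceil>of_int N * K'\<rceil> .. \<lceil>of_int N * K'\<rceil>}" by blast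
    qed
  qed simp
  let ?T = "{p :: rat poly. (\<forall>i. coeff p i \<in> S) \<and> (\<forall>i\<ge>degree \<mu>. coeff p i = 0)}"
  have "Y \<inter> {-R..R} \<subseteq> (\<lambda>p. poly (map_poly of_rat p) q) ` ?T"
  proof
    fix y assume y: "y \<in> Y \<inter> {-R..R}"
    then obtain P :: "int poly" where P: "y = poly (map_poly of_int P) q" "\<And>i. \<bar>coeff P i\<bar> \<le> int m"
      by (auto elim: Y_poly)
    define PQ where "PQ = (map_poly of_int P :: rat poly)"
    define PC where "PC = (map_poly of_rat PQ :: complex poly)"
    define r0 where "r0 = PQ mod \<mu>"
    have PC: "PC = map_poly of_int P" by (simp add: PC_def PQ_def map_poly_map_poly o_def)
    have ev: "poly PC (of_real q) = of_real y" by (simp add: PC poly_of_int_of_real P(1))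
    have yr: "y = poly (map_poly of_rat r0) q"
    proof -
      have "PQ = \<mu> * (PQ div \<mu>) + r0" by (simp add: r0_def)
      then have "map_poly of_rat PQ = (map_poly of_rat \<mu> * map_poly of_rat (PQ div \<mu>) + map_poly of_rat r0 :: real poly)"
        by (metis RR.map_poly_add RR.map_poly_mult)
      then have "poly (map_poly of_rat PQ) q = poly (map_poly of_rat r0) q"
        using \<mu>(1) by (simp add: is_min_poly_def)
      then show ?thesis by (simp add: P(1) PQ_def poly_of_rat_int)
    qed
    have coeffPC: "norm (coeff PC i) \<le> real m" for i
      using P(2)[of i] by (simp add: PC coeff_map_poly)
    have "norm (coeff (synthetic_div PC (of_real q)) i) \<le> R'" for i
      using synthetic_div_bound_expanding[OF q_gt_1 coeffPC, of R' i] y by (auto simp: R'_def ev)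
    then obtain r s where rs: "synthetic_div PC (of_real q) = (\<Prod>w\<leftarrow>ws. [:- w, 1:]) * s + r"
      "\<And>i. norm (coeff r i) \<le> K" "\<And>i. i \<ge> length ws \<Longrightarrow> coeff r i = 0" using K by blast
    define r1 where "r1 = [:- of_real q, 1:] * r + [:of_real y:]"
    have "norm (of_real y :: complex) \<le> R'" using y by (auto simp: R'_def)
    note r1 = linear_factor_remainder_bound[where w = "of_real q" and n = "length ws", OF rs(2) this rs(3), folded r1_def K'_def]
    have "PC = [:- of_real q, 1:] * synthetic_div PC (of_real q) + [:of_real y:]"
      using synthetic_div_correct'[of "of_real q" PC] by (simp add: ev)
    also have "\<dots> = F * s + r1"
      unfolding rs(1) Fprod r1_def by (simp add: algebra_simps)
    finally have PC1: "PC = F * s + r1" .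
    have "PQ = \<mu> * (PQ div \<mu>) + r0" by (simp add: r0_def)
    then have PC2: "PC = F * map_poly of_rat (PQ div \<mu>) + map_poly of_rat r0"
      unfolding PC_def F_def by (metis RC.map_poly_add RC.map_poly_mult)
    have deg_r1: "degree r1 < degree F"
      using r1(2) lenws by (intro degree_lessI) auto
    have deg_r0: "r0 = 0 \<or> degree r0 < degree \<mu>"
      unfolding r0_def by (rule degree_mod_less) (use \<mu> in \<open>auto simp: is_min_poly_def\<close>)
    have deg_r0': "degree (map_poly of_rat r0 :: complex poly) < degree F"
      using deg_r0 degF lenws map_poly_degree_leq[of "of_rat :: rat \<Rightarrow> complex" r0] by auto
    \<comment> \<open>Uniqueness of the remainder: the bounded complex \<open>r1\<close> is the
      image of the rational \<open>r0\<close>.\<close>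
    have "F * (s - map_poly of_rat (PQ div \<mu>)) = map_poly of_rat r0 - r1"
      using PC1 PC2 by (simp add: algebra_simps)
    moreover have "degree (map_poly of_rat r0 - r1) < degree F"
      using deg_r1 deg_r0' by (rule degree_diff_less[rotated])
    ultimately have "map_poly of_rat r0 - r1 = 0"
      using F0 by (metis add_diff_cancel_left' add_lessD1 degree_mult_eq mult_eq_0_iff nat_neq_iff not_add_less1)
    then have r01: "map_poly of_rat r0 = r1" by simp
    have small: "\<bar>real_of_rat (coeff r0 i)\<bar> \<le> K'" for i
    proof -
      have "complex_of_real (of_rat (coeff r0 i)) = coeff r1 i"
        by (simp add: r01[symmetric] coeff_map_poly complex_of_real_of_rat)
      then show ?thesis using r1(1)[of i] by (metis norm_of_real)
    qed
    have int: "of_int N * coeff r0 j \<in> \<int>" for j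
    proof -
      \<comment> \<open>As \<open>g\<close> is monic, pseudo-division is ordinary division.\<close>
      obtain a b where ab: "pseudo_divmod P g = (a, b)" by (cases "pseudo_divmod P g")
      have Pgb: "P = g * a + b" "b = 0 \<or> degree b < degree g"
        using pseudo_divmod[OF g0 ab] g(2) by auto
      have "\<mu> dvd map_poly of_int g"
        by (rule min_poly_dvd[OF \<mu>(1)]) (simp add: poly_of_rat_int g(1))
      then have "r0 = map_poly of_int b mod \<mu>"
        unfolding r0_def PQ_def Pgb(1) IR.map_poly_add IR.map_poly_mult
        by (metis dvd_mult2 dvd_imp_mod_0 mod_add_left_eq add_0)
      moreover have "map_poly of_int b = (\<Sum>i<degree g. smult (of_int (coeff b i)) (monom 1 i) :: rat poly)"
        using Pgb(2) by (intro poly_eqI) (auto simp: coeff_map_poly coeff_sum sum.delta coeff_eq_0 if_distrib cong: if_cong)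
      ultimately have "coeff r0 j = (\<Sum>i<degree g. of_int (coeff b i) * coeff (monom 1 i mod \<mu>) j)"
        by (simp add: coeff_sum mod_sum_poly mod_smult_left)
      then have "of_int N * coeff r0 j = (\<Sum>i<degree g. of_int (coeff b i) * (of_int N * coeff (monom 1 i mod \<mu>) j))"
        by (simp add: sum_distrib_left mult_ac)
      also have "\<dots> \<in> \<int>" by (intro Ints_sum Ints_mult[OF Ints_of_int] N(2)) simp
      finally show ?thesis .
    qed
    have "r0 \<in> ?T" using small int deg_r0 by (auto simp: S_def coeff_eq_0)
    then show "y \<in> (\<lambda>p. poly (map_poly of_rat p) q) ` ?T" using yr by blast
  qed
  then show ?thesis
    using finite_polys_bounded[OF finS, of "degree \<mu>"] by (rule finite_subset[OF _ finite_imageI])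
qed

end

section \<open>The characterization\<close>

lemma islimpt_iff_infinite_interval:
  "(\<exists>\<alpha>. \<alpha> islimpt S) \<longleftrightarrow> (\<exists>R. infinite (S \<inter> {-R..R :: real}))"
proof
  assume "\<exists>\<alpha>. \<alpha> islimpt S"
  then obtain \<alpha> where "\<alpha> islimpt S" by blast
  then have "infinite (S \<inter> ball \<alpha> 1)" by (simp add: islimpt_eq_infinite_ball)
  moreover have "S \<inter> ball \<alpha> 1 \<subseteq> S \<inter> {- (\<bar>\<alpha>\<bar> + 1)..\<bar>\<alpha>\<bar> + 1}"
    by (auto simp: dist_real_def)
  ultimately show "\<exists>R. infinite (S \<inter> {-R..R})" using finite_subset by blast
next
  assume "\<exists>R. infinite (S \<inter> {-R..R})"
  then obtain R where "infinite (S \<inter> {-R..R})" by blast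
  then obtain \<alpha> where "\<alpha> islimpt (S \<inter> {-R..R})"
    using Heine_Borel_imp_Bolzano_Weierstrass[of "{-R..R}" "S \<inter> {-R..R}"] by auto
  then show "\<exists>\<alpha>. \<alpha> islimpt S" using islimpt_subset by blast
qed

lemma pisot_Ints:
  assumes "q > 1" "q \<in> \<int>"
  shows "pisot q"
proof -
  obtain k where k: "q = of_int k" using assms by (auto elim: Ints_cases)
  have "w = of_real q" if "alg_conjugate (of_real q) w" for w
  proof -
    have "poly (map_poly of_int [:- k, 1:]) (complex_of_real q) = 0" by (simp add: k map_poly_pCons)
    then have "poly (map_poly of_int [:- k, 1:]) w = 0"
      using conjugate_poly_eq_0_iff[OF that] by blast
    then show ?thesis by (simp add: k map_poly_pCons)
  qed
  then show ?thesis using assms by (auto simp: pisot_def int_imp_algebraic_int)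
qed

text \<open>With \<open>n = degree P\<close> the left side is
  \<open>q ^ n - m * (q ^ (n - 1) + ... + 1)\<close> in closed form: the leading coefficient is at
  least 1 in absolute value, the others at most \<open>m\<close>.\<close>

lemma poly_lower_bound:
  fixes P :: "int poly"
  assumes q: "q > 1" and "P \<noteq> 0" "\<And>i. \<bar>coeff P i\<bar> \<le> int m"
  shows "(1 - real m / (q - 1)) * q ^ degree P + real m / (q - 1) \<le> \<bar>poly (map_poly of_int P) q\<bar>"
  using assms(2,3)
proof (induction P)
  case (pCons a P)
  have PK: "\<bar>coeff P i\<bar> \<le> int m" for i using pCons.prems(2)[of "Suc i"] by simp
  show ?case
  proof (cases "P = 0")
    case True
    then have "\<bar>a\<bar> \<ge> 1" using pCons by auto
    then have "\<bar>real_of_int a\<bar> \<ge> 1" by linarith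
    then show ?thesis using True by (simp add: map_poly_pCons)
  next
    case False
    let ?c = "1 - real m / (q - 1)" and ?d = "real m / (q - 1)"
    have d: "q * ?d - real m = ?d" using q by (simp add: field_simps)
    have "?c * q ^ degree (pCons a P) + ?d = q * (?c * q ^ degree P + ?d) - real m"
      using False d by (simp add: algebra_simps)
    also have "\<dots> \<le> q * \<bar>poly (map_poly of_int P) q\<bar> - real m"
      using pCons.IH[OF False PK] q by (intro diff_right_mono mult_left_mono) auto
    also have "\<dots> \<le> q * \<bar>poly (map_poly of_int P) q\<bar> - \<bar>real_of_int a\<bar>"
      using pCons.prems(2)[of 0] by (simp add: abs_le_iff)
    also have "\<dots> = \<bar>q * poly (map_poly of_int P) q\<bar> - \<bar>real_of_int a\<bar>" using q by (simp add: abs_mult)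
    also have "\<dots> \<le> \<bar>poly (map_poly of_int (pCons a P)) q\<bar>" by (simp add: map_poly_pCons)
    finally show ?thesis .
  qed
qed simp

text \<open>Multiplying by \<open>1 - v\<close> with \<open>v = 1 / z\<close> turns the decreasing coefficients into a convex combination.\<close>
lemma enestrom_kakeya:
  fixes y :: "nat \<Rightarrow> real" and z :: complex
  assumes pos: "\<And>j. j \<le> k \<Longrightarrow> y j > 0" and dec: "\<And>j. j < k \<Longrightarrow> y (Suc j) < y j"
    and root: "(\<Sum>j\<le>k. of_real (y j) * z ^ (k - j)) = 0"
  shows "norm z < 1"
proof (rule ccontr)
  assume "\<not> norm z < 1"
  then have z: "norm z \<ge> 1" "z \<noteq> 0" by auto
  define v where "v = 1 / z"
  have v: "norm v \<le> 1" using z by (simp add: v_def norm_divide)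
  have "(\<Sum>j\<le>k. of_real (y j) * v ^ j) * z ^ k = (\<Sum>j\<le>k. of_real (y j) * z ^ (k - j))"
    unfolding sum_distrib_right by (intro sum.cong) (use z in \<open>auto simp: v_def power_diff power_divide field_simps\<close>)
  then have S: "(\<Sum>j\<le>k. of_real (y j) * v ^ j) = 0" using root z by simp
  have k: "k \<noteq> 0" using S pos[of 0] by (intro notI) simp
  have tel: "(1 - v) * (\<Sum>j\<le>n. of_real (y j) * v ^ j) =
      of_real (y 0) - (\<Sum>j<n. of_real (y j - y (Suc j)) * v ^ Suc j) - of_real (y n) * v ^ Suc n" for n
    by (induction n) (simp_all add: algebra_simps)
  have vj: "Re (v ^ j) \<le> 1" for j
    using complex_Re_le_cmod[of "v ^ j"] v by (simp add: norm_power power_le_one order_trans)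
  have "0 = y 0 - (\<Sum>j<k. (y j - y (Suc j)) * Re (v ^ Suc j)) - y k * Re (v ^ Suc k)"
    using arg_cong[OF tel[of k], of Re] S by (simp add: Re_sum)
  \<comment> \<open>All powers of \<open>v\<close> are estimated by 1 except for
    \<open>j = 0\<close>, whose positive coefficient \<open>y 0 - y 1\<close> will force
    \<open>Re v \<ge> 1\<close>.\<close>
  also have "\<dots> \<ge> y 0 - (\<Sum>j<k. (y j - y (Suc j)) * (if j = 0 then Re v else 1)) - y k * 1"
    using vj dec pos[of k] by (intro diff_mono sum_mono mult_left_mono) (auto intro: less_imp_le simp del: power_Suc)
  also have "(\<Sum>j<k. (y j - y (Suc j)) * (if j = 0 then Re v else 1))
      = (\<Sum>j<k. y j - y (Suc j)) - (y 0 - y 1) * (1 - Re v)"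
    using k by (cases k) (simp_all add: sum.lessThan_Suc_shift algebra_simps del: sum.lessThan_Suc)
  also have "(\<Sum>j<k. y j - y (Suc j)) = y 0 - y k"
    by (rule sum_lessThan_telescope')
  finally have "(y 0 - y 1) * (1 - Re v) \<le> 0" by simp
  then have "Re v \<ge> 1" using dec[of 0] k by (simp add: mult_le_0_iff)
  then have "v = 1" using Re_eq_norm_imp_eq[OF v] by simp
  then have "complex_of_real (\<Sum>j\<le>k. y j) = 0" using S by simp
  moreover have "(\<Sum>j\<le>k. y j) > 0" using pos by (intro sum_pos) auto
  ultimately show False by (simp only: of_real_eq_0_iff less_irrefl)
qed

text \<open>The leading term dominates, so a bounded value bounds the degree.\<close>

lemma (in spectrum) finite_Y_large:
  assumes "q > real m + 1"
  shows "finite (Y \<inter> {-R..R})"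
proof -
  let ?c = "1 - real m / (q - 1)"
  have c: "?c > 0" using assms m_pos by (simp add: field_simps)
  obtain n where n: "R / ?c < q ^ n" using real_arch_pow[OF q_gt_1] by blast
  let ?T = "{P :: int poly. (\<forall>i. coeff P i \<in> {- int m..int m}) \<and> (\<forall>i\<ge>n. coeff P i = 0)}"
  have "Y \<inter> {-R..R} \<subseteq> insert 0 ((\<lambda>P. poly (map_poly of_int P) q) ` ?T)"
  proof
    fix y assume y: "y \<in> Y \<inter> {-R..R}"
    then obtain P :: "int poly" where P: "y = poly (map_poly of_int P) q" "\<And>i. \<bar>coeff P i\<bar> \<le> int m"
      by (auto elim: Y_poly)
    show "y \<in> insert 0 ((\<lambda>P. poly (map_poly of_int P) q) ` ?T)"
    proof (cases "P = 0")
      case False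
      have "?c * q ^ degree P \<le> \<bar>y\<bar>"
        using poly_lower_bound[OF q_gt_1 False P(2), folded P(1)] L_pos unfolding L_def by linarith
      also have "\<dots> \<le> R" using y by auto
      also have "R < ?c * q ^ n" using n c by (simp add: field_simps)
      finally have "q ^ degree P < q ^ n" using c by simp
      then have "degree P < n" using q_gt_1 by simp
      then have "P \<in> ?T" using P(2) by (auto simp: coeff_eq_0 abs_le_iff minus_le_iff)
      then show ?thesis using P(1) by blast
    qed (simp add: P(1))
  qed
  moreover have "finite (insert 0 ((\<lambda>P. poly (map_poly of_int P) q) ` ?T))"
    by (intro finite.insertI finite_imageI finite_polys_bounded) simp
  ultimately show ?thesis by (rule finite_subset)
qed

section \<open>Conjugates when the expansion of 1 terminates\<close>

context spectrum_overlap
begin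

primrec horner_poly :: "nat \<Rightarrow> int poly" where
  "horner_poly 0 = 1"
| "horner_poly (Suc k) = pCons (- int m) (horner_poly k)"

lemma poly_horner_poly: "poly (map_poly of_int (horner_poly k)) q = horner k"
  by (induction k) (simp_all add: map_poly_pCons horner_Suc)

lemma sum_power_shift:
  fixes z :: complex
  shows "(\<Sum>j<k. f j * z ^ (k - j)) = z * (\<Sum>j<k. f j * z ^ (k - Suc j))"
proof -
  have "z ^ (k - j) = z * z ^ (k - Suc j)" if "j < k" for j
    using that by (metis Suc_diff_Suc power_Suc)
  then show ?thesis by (simp add: sum_distrib_left mult.left_commute)
qed

text \<open>Synthetic division by \<open>x - q\<close>: the quotient has the intermediate Horner
  values as coefficients.\<close>

lemma horner_poly_at_other:
  fixes z :: complex
  shows "poly (map_poly of_int (horner_poly k)) z - of_real (horner k) =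
    (z - of_real q) * (\<Sum>j<k. of_real (horner j) * z ^ (k - Suc j))"
proof (induction k)
  case (Suc k)
  have "(\<Sum>j<Suc k. of_real (horner j) * z ^ (Suc k - Suc j))
      = z * (\<Sum>j<k. of_real (horner j) * z ^ (k - Suc j)) + of_real (horner k)"
    by (simp add: sum_power_shift)
  moreover have "poly (map_poly of_int (horner_poly (Suc k))) z - of_real (horner (Suc k)) =
      z * (poly (map_poly of_int (horner_poly k)) z - of_real (horner k))
      + (z - of_real q) * of_real (horner k)"
    by (simp add: map_poly_pCons horner_Suc algebra_simps)
  ultimately show ?case unfolding Suc by (simp add: distrib_left mult.left_commute)
qed simp

text \<open>The polynomial \<open>x * horner_poly k - s\<close> vanishes at \<open>q\<close>.
  Removing the factor \<open>x - q\<close> leaves the coefficients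
  \<open>horner 0, ..., horner k\<close>, which are positive and decreasing.\<close>

lemma simple_conjugate_small:
  assumes s: "q * horner k = real s" and pos: "\<And>j. j \<le> k \<Longrightarrow> horner j > 0"
    and conj: "alg_conjugate (of_real q) z" and z: "z \<noteq> of_real q"
  shows "norm z < 1"
proof -
  have "poly (map_poly of_int (pCons (- int s) (horner_poly k))) q = 0"
    using s by (simp add: map_poly_pCons poly_horner_poly)
  then have "poly (map_poly of_int (pCons (- int s) (horner_poly k))) z = 0"
    using conjugate_poly_eq_0_iff_real[OF conj] by blast
  then have "z * poly (map_poly of_int (horner_poly k)) z = of_nat s"
    by (simp add: map_poly_pCons)
  moreover have "of_nat s = of_real q * (of_real (horner k) :: complex)"
    using arg_cong[OF s, of complex_of_real] by simp
  ultimately have "z * (poly (map_poly of_int (horner_poly k)) z - of_real (horner k))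
      + (z - of_real q) * of_real (horner k) = 0"
    by (simp add: algebra_simps)
  then have "(z - of_real q) * (z * (\<Sum>j<k. of_real (horner j) * z ^ (k - Suc j)) + of_real (horner k)) = 0"
    unfolding horner_poly_at_other by (simp add: algebra_simps)
  then have "z * (\<Sum>j<k. of_real (horner j) * z ^ (k - Suc j)) + of_real (horner k) = 0"
    using z by simp
  moreover have "(\<Sum>j\<le>k. of_real (horner j) * z ^ (k - j))
      = z * (\<Sum>j<k. of_real (horner j) * z ^ (k - Suc j)) + of_real (horner k)"
    by (simp add: lessThan_Suc_atMost[symmetric] sum_power_shift)
  ultimately show ?thesis
    using enestrom_kakeya[of k horner z] pos horner_decreasing by simp
qed

end

section \<open>Integrality of \<open>q\<close> and the converse direction\<close>

context spectrum_overlap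
begin

primrec orbit_poly :: "nat \<Rightarrow> int poly" where
  "orbit_poly 0 = 1"
| "orbit_poly (Suc i) = pCons (- \<lfloor>q * orbit i\<rfloor>) (orbit_poly i)"

lemma orbit_poly: "poly (map_poly of_int (orbit_poly i)) q = orbit i"
  by (induction i) (simp_all add: map_poly_pCons)

lemma orbit_poly_monic: "lead_coeff (orbit_poly i) = 1 \<and> degree (orbit_poly i) = i"
  by (induction i) auto

text \<open>The greedy orbit stays in a finite set, so two of its values coincide; their monic
  polynomials have different degrees and a monic difference.\<close>

lemma algebraic_int_q:
  assumes fin: "\<And>R. finite (Y \<inter> {-R..R})"
  shows "algebraic_int q"
proof -
  have "orbit i \<in> Y \<inter> {-1..1}" for i
    using orbit_Y[of i] orbit_bounds[of i] by auto
  then have "finite (range orbit)" by (intro finite_subset[OF image_subsetI fin[of 1]])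
  then have "\<not> inj orbit" using finite_imageD infinite_UNIV_nat by blast
  then obtain i j where ij: "i < j" "orbit i = orbit j"
    by (auto simp: inj_def) (metis linorder_neqE_nat)
  let ?P = "orbit_poly j - orbit_poly i"
  have "degree (- orbit_poly i) < degree (orbit_poly j)" using ij orbit_poly_monic by simp
  then have "lead_coeff (- orbit_poly i + orbit_poly j) = lead_coeff (orbit_poly j)"
    by (rule lead_coeff_add_le)
  also have "\<dots> = 1" using orbit_poly_monic by blast
  also have "- orbit_poly i + orbit_poly j = ?P" by simp
  finally have "lead_coeff ?P = 1" .
  moreover have "poly (map_poly of_int ?P) q = 0"
    using ij by (simp add: ring_embedding.map_poly_diff[OF ring_embedding_of_int] orbit_poly)
  ultimately show ?thesis unfolding algebraic_int_altdef_ipoly by (intro exI[of _ ?P]) auto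
qed

lemma pisot_if_finite:
  assumes fin: "\<And>R. finite (Y \<inter> {-R..R})"
  shows "pisot q"
proof (cases "q \<in> \<rat>")
  case True
  then show ?thesis
    using rational_algebraic_int_is_int[OF algebraic_int_q[OF fin]] pisot_Ints q_gt_1 by blast
next
  case irr: False
  have "norm z < 1" if z: "alg_conjugate (of_real q) z" "z \<noteq> of_real q" for z
    using dichotomy
  proof cases
    case (simple k s)
    show ?thesis by (rule simple_conjugate_small[OF simple(2,3) z])
  next
    case (overlap a)
    show ?thesis
    proof (rule ccontr)
      assume "\<not> norm z < 1"
      interpret expanding_conjugate q m z
      proof unfold_locales
        show "norm z \<ge> 1" using \<open>\<not> norm z < 1\<close> by simp
      qed (fact conjugate_poly_eq_0_iff_real[OF z(1)] fin z(2))+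
      obtain A B :: int and h where h: "h = of_int A * a + of_int B * (a / q)" "h > 0"
        "finite (\<Union>i. {y - q ^ i * h | y. y \<in> Y \<and> \<bar>y - q ^ i * h\<bar> \<le> L})"
        by (rule uniform_shift_exists[OF fin irr overlap])
      have int_mult: "of_int C * x \<in> Zq" if "x \<in> Zq" for C x
      proof -
        obtain P where "x = poly (map_poly of_int P) q" using \<open>x \<in> Zq\<close> by (rule Zq_cases)
        then have "of_int C * x = poly (map_poly of_int (smult C P)) q"
          by (simp add: ring_embedding.map_poly_smult_hom[OF ring_embedding_of_int])
        then show ?thesis unfolding Zq_def by blast
      qed
      \<comment> \<open>\<open>h\<close> involves \<open>a / q\<close> and may lie outside
        \<open>Zq\<close>, so it is replaced by \<open>q * h\<close>; this only shifts the index
        \<open>i\<close> by one.\<close>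
      have "q * h = q * (of_int A * a) + of_int B * a"
        using q_gt_1 by (simp add: h(1) field_simps)
      moreover have "a \<in> Zq" using Y_subset_Zq overlap by blast
      ultimately have "q * h \<in> Zq"
        using int_mult[of a] conj_map_mult_power[of "of_int A * a" 1] conj_map_add by auto
      moreover have "finite (\<Union>i. {y - q ^ i * (q * h) | y. y \<in> Y \<and> \<bar>y - q ^ i * (q * h)\<bar> \<le> 1})"
      proof (rule finite_subset[OF _ h(3)])
        show "(\<Union>i. {y - q ^ i * (q * h) | y. y \<in> Y \<and> \<bar>y - q ^ i * (q * h)\<bar> \<le> 1})
            \<subseteq> (\<Union>i. {y - q ^ i * h | y. y \<in> Y \<and> \<bar>y - q ^ i * h\<bar> \<le> L})"
        proof
          fix x assume "x \<in> (\<Union>i. {y - q ^ i * (q * h) | y. y \<in> Y \<and> \<bar>y - q ^ i * (q * h)\<bar> \<le> 1})"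
          then obtain i y where "x = y - q ^ Suc i * h" "y \<in> Y" "\<bar>x\<bar> \<le> 1"
            by (auto simp: mult_ac)
          then show "x \<in> (\<Union>i. {y - q ^ i * h | y. y \<in> Y \<and> \<bar>y - q ^ i * h\<bar> \<le> L})"
            using L_gt_1 by (intro UN_I[of "Suc i"]) (auto simp del: power_Suc)
        qed
      qed
      moreover have "q * h > 0" using h(2) q_gt_1 by simp
      ultimately interpret shifted_conjugate q m z "q * h"
        by unfold_locales
      show False by (rule no_expanding_conjugate)
    qed
  qed
  then show ?thesis using algebraic_int_q[OF fin] q_gt_1 by (auto simp: pisot_def)
qed

end

theorem theorem1p1:
  fixes q :: real and m :: nat
  assumes "q > 1" and "m > 0"
  shows "\<not> (\<exists>\<alpha>. \<alpha> islimpt Y_set m q) \<longleftrightarrow> pisot q \<or> q \<ge> real m + 1"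
proof -
  interpret spectrum q m using assms by unfold_locales
  show ?thesis
  proof
    assume "\<not> (\<exists>\<alpha>. \<alpha> islimpt Y_set m q)"
    then have fin: "finite (Y_set m q \<inter> {-R..R})" for R
      by (auto simp: islimpt_iff_infinite_interval)
    show "pisot q \<or> q \<ge> real m + 1"
    proof (cases "q < real m + 1")
      case True
      then interpret spectrum_overlap q m by unfold_locales
      show ?thesis using pisot_if_finite[OF fin] by simp
    qed simp
  next
    assume *: "pisot q \<or> q \<ge> real m + 1"
    \<comment> \<open>In the boundary case \<open>q\<close> is an integer, so the degree bound is
      needed for \<open>q > m + 1\<close> only.\<close>
    have "pisot q" if "q = real m + 1"
      using that assms(1) by (intro pisot_Ints) auto
    then have "pisot q \<or> q > real m + 1" using * by fastforce
    then show "\<not> (\<exists>\<alpha>. \<alpha> islimpt Y_set m q)"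
      unfolding islimpt_iff_infinite_interval using finite_Y_pisot finite_Y_large by blast
  qed
qed

end
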